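(* Let $q$ be a prime power, $G=GL(3,\mathbb F_q)$, and let $Z\cong\mathbb F_q^\times$ be the center of $G$. Let $\psi$ be a character of $\mathbb F_{q^3}^\times$ with $\psi\ne\psi^q$ (where $\psi^q(x)=\psi(x^q)$), let $\beta,\gamma,\delta$ be pairwise distinct characters of $\mathbb F_q^\times$, and let $\varphi$ be a non-trivial character of the additive group $\mathbb F_q^+$. Let $$N=\left\{\begin{pmatrix}1&x&z\\0&1&y\\0&0&1\end{pmatrix}: x,y,z\in\mathbb F_q\right\},\qquad N_1=\left\{\begin{pmatrix}1&0&z\\0&1&y\\0&0&1\end{pmatrix}: y,z\in\mathbb F_q\right\},$$ and view $\varphi$ as a character of $N$ (and, by restriction, of $N_1$) by sending the displayed matrix with entries $x,y,z$ to $\varphi(x+y)$. Let $(\psi\beta\gamma\delta)\varphi$ denote the linear character of $ZN$ (respectively of $ZN_1$) given by $(aI)u\mapsto\psi(a)\beta(a)\gamma(a)\delta(a)\,\varphi(u)$ for $a\in\mathbb F_q^\times$ and $u\in N$ (respectively $u\in N_1$). Then $$\chi_\psi^{(q-1)(q^2-1)}\otimes\chi_{\beta,\gamma,\delta}^{(q+1)(q^2+q+1)}=\mathrm{Ind}_{ZN}^G\big((\psi\beta\gamma\delta)\varphi\big)+\mathrm{Ind}_{ZN_1}^G\big((\psi\beta\gamma\delta)\varphi\big).$$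
   Context: A representation and its character are denoted by the same symbol, and the identity is one of characters of $G$ (equivalently, an isomorphism of complex representations); $\otimes$ corresponds to the pointwise product of characters. Fix generators $\tau$ of $\mathbb F_{q^2}$ and $\sigma$ of $\mathbb F_{q^3}$ over $\mathbb F_q$; identify $w\in\mathbb F_{q^2}$ with the $2\times2$ matrix of multiplication by $w$ in the basis $\{1,\tau\}$, and $z\in\mathbb F_{q^3}$ with the $3\times3$ matrix of multiplication by $z$ in the basis $\{1,\sigma,\sigma^2\}$. Representatives of the conjugacy classes of $G$ are of the types (with $a,b,c\in\mathbb F_q^\times$ pairwise distinct, $\varkappa\in\mathbb F_{q^2}\setminus\mathbb F_q$, $z\in\mathbb F_{q^3}\setminus\mathbb F_q$): $T^a=aI$; $T_1^a$ = the matrix with diagonal $(a,a,a)$ and one further nonzero entry, a $1$ in position $(1,2)$; $T_{11}^a$ = the single Jordan block of size 3 with eigenvalue $a$; $T^{ab}=\mathrm{diag}(a,a,b)$; $T_1^{ab}$ = $T^{ab}$ plus a $1$ in position $(1,2)$; $T^{abc}=\mathrm{diag}(a,b,c)$; $T^{\varkappa a}=\mathrm{diag}(\varkappa,a)$ (block diagonal); $T^z=z$. $\chi_\psi^{(q-1)(q^2-1)}$ (discrete series) is the irreducible character of $G$ with values on $(T^a,T_1^a,T_{11}^a,T^{ab},T_1^{ab},T^{abc},T^{\varkappa a},T^z)$, in this order: $(q-1)(q^2-1)\psi(a)$; $-(q-1)\psi(a)$; $\psi(a)$; $0$; $0$; $0$; $0$; $\psi(z)+\psi(z^q)+\psi(z^{q^2})$.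 $\chi_{\beta,\gamma,\delta}^{(q+1)(q^2+q+1)}$ (principal series) is the irreducible character of $G$ with values, in the same order: $(q+1)(q^2+q+1)\,\beta\gamma\delta(a)$; $(2q+1)\,\beta\gamma\delta(a)$; $\beta\gamma\delta(a)$; $(q+1)[\beta\gamma(a)\delta(b)+\beta\delta(a)\gamma(b)+\gamma\delta(a)\beta(b)]$; $\beta\gamma(a)\delta(b)+\beta\delta(a)\gamma(b)+\gamma\delta(a)\beta(b)$; the sum of the six terms obtained from $\beta(a)\gamma(b)\delta(c)$ by permuting $\beta,\gamma,\delta$; $0$; $0$. *)

theory Defs
  imports "HOL-Analysis.Determinants" "HOL-Algebra.Coset"
begin

section \<open>Complex characters of finite groups\<close>

definition GL :: "('a::field ^ 'n ^ 'n) monoid" where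
  "GL = \<lparr>carrier = {A. invertible A}, monoid.mult = (**), one = mat 1\<rparr>"

text \<open>Invariance is taken with respect to complex subspaces (\<^term>\<open>vec.subspace\<close>, not the
  real \<^term>\<open>subspace\<close>); the zero representation cannot occur since index types are nonempty.\<close>

definition irreducible_representation ::
    "'g monoid \<Rightarrow> ('g \<Rightarrow> complex ^ 'n ^ 'n) \<Rightarrow> bool" where
  "irreducible_representation G \<rho> \<longleftrightarrow>
     \<rho> \<in> hom G GL \<and>
     (\<forall>W. vec.subspace W \<and> (\<forall>g\<in>carrier G. \<forall>w\<in>W. \<rho> g *v w \<in> W) \<longrightarrow> W = {0} \<or> W = UNIV)"

definition character :: "('g \<Rightarrow> complex ^ 'n ^ 'n) \<Rightarrow> 'g \<Rightarrow> complex" where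
  "character \<rho> g = trace (\<rho> g)"

definition induced_character ::
    "'g monoid \<Rightarrow> 'g set \<Rightarrow> ('g \<Rightarrow> complex) \<Rightarrow> 'g \<Rightarrow> complex" where
  "induced_character G H \<theta> g =
     (\<Sum>x\<in>carrier G. let y = m_inv G x \<otimes>\<^bsub>G\<^esub> g \<otimes>\<^bsub>G\<^esub> x in if y \<in> H then \<theta> y else 0)
     / of_nat (card H)"

definition center :: "'g monoid \<Rightarrow> 'g set" where
  "center G = {z \<in> carrier G. \<forall>g\<in>carrier G. z \<otimes>\<^bsub>G\<^esub> g = g \<otimes>\<^bsub>G\<^esub> z}"

section \<open>Fields, their characters and extensions\<close>

definition units_group :: "'a::field monoid" where
  "units_group = \<lparr>carrier = - {0}, monoid.mult = (*), one = 1\<rparr>"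

definition additive_group :: "'a::field monoid" where
  "additive_group = \<lparr>carrier = UNIV, monoid.mult = (+), one = 0\<rparr>"

text \<open>The value of a multiplicative character at 0 is unspecified and irrelevant, so such
  characters must be compared on nonzero elements only.\<close>

definition mult_character :: "('a::field \<Rightarrow> complex) \<Rightarrow> bool" where
  "mult_character \<theta> \<longleftrightarrow> \<theta> \<in> hom units_group units_group"

definition add_character :: "('a::field \<Rightarrow> complex) \<Rightarrow> bool" where
  "add_character \<phi> \<longleftrightarrow> \<phi> \<in> hom additive_group units_group"

definition field_embedding :: "('a::field \<Rightarrow> 'b::field) \<Rightarrow> bool" where
  "field_embedding \<iota> \<longleftrightarrow> \<iota> 1 = 1 \<and> (\<forall>x y. \<iota> (x + y) = \<iota> x + \<iota> y) \<and> (\<forall>x y. \<iota> (x * y) = \<iota> x * \<iota> y)"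

definition is_subfield :: "'a::field set \<Rightarrow> bool" where
  "is_subfield S \<longleftrightarrow> 1 \<in> S \<and> (\<forall>x\<in>S. \<forall>y\<in>S. x - y \<in> S \<and> x * y \<in> S \<and> inverse x \<in> S)"

definition generator_over :: "('a::field \<Rightarrow> 'b::field) \<Rightarrow> 'b \<Rightarrow> bool" where
  "generator_over \<iota> t \<longleftrightarrow> is_subfield hull (insert t (range \<iota>)) = UNIV"

text \<open>The matrix of multiplication by \<open>w\<close> in the basis \<open>B\<close>, scalars being embedded along \<open>\<iota>\<close>;
  column \<open>j\<close> holds the coordinates of \<open>w * B $ j\<close>.\<close>

definition mult_matrix ::
    "('a::field \<Rightarrow> 'b::field) \<Rightarrow> 'b ^ 'n \<Rightarrow> 'b \<Rightarrow> 'a ^ 'n ^ 'n" where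
  "mult_matrix \<iota> B w = (THE M. \<forall>j. w * B $ j = (\<Sum>i\<in>UNIV. \<iota> (M $ i $ j) * B $ i))"

section \<open>Class representatives in \<open>GL(3)\<close>\<close>

definition mat3 :: "'a::field list list \<Rightarrow> 'a ^ 3 ^ 3" where
  "mat3 xss = vector (map vector xss)"

definition T_a :: "'a::field \<Rightarrow> 'a ^ 3 ^ 3" where
  "T_a a = mat3 [[a, 0, 0], [0, a, 0], [0, 0, a]]"

definition T1_a :: "'a::field \<Rightarrow> 'a ^ 3 ^ 3" where
  "T1_a a = mat3 [[a, 1, 0], [0, a, 0], [0, 0, a]]"

definition T11_a :: "'a::field \<Rightarrow> 'a ^ 3 ^ 3" where
  "T11_a a = mat3 [[a, 1, 0], [0, a, 1], [0, 0, a]]"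

definition T_ab :: "'a::field \<Rightarrow> 'a \<Rightarrow> 'a ^ 3 ^ 3" where
  "T_ab a b = mat3 [[a, 0, 0], [0, a, 0], [0, 0, b]]"

definition T1_ab :: "'a::field \<Rightarrow> 'a \<Rightarrow> 'a ^ 3 ^ 3" where
  "T1_ab a b = mat3 [[a, 1, 0], [0, a, 0], [0, 0, b]]"

definition T_abc :: "'a::field \<Rightarrow> 'a \<Rightarrow> 'a \<Rightarrow> 'a ^ 3 ^ 3" where
  "T_abc a b c = mat3 [[a, 0, 0], [0, b, 0], [0, 0, c]]"

definition T_ka :: "('a::field \<Rightarrow> 'b::field) \<Rightarrow> 'b \<Rightarrow> 'b \<Rightarrow> 'a \<Rightarrow> 'a ^ 3 ^ 3" where
  "T_ka \<iota> \<tau> \<kappa> a =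
     (let M = (mult_matrix \<iota> (vector [1, \<tau>]) \<kappa> :: 'a ^ 2 ^ 2)
      in mat3 [[M $ 1 $ 1, M $ 1 $ 2, 0], [M $ 2 $ 1, M $ 2 $ 2, 0], [0, 0, a]])"

definition T_z :: "('a::field \<Rightarrow> 'b::field) \<Rightarrow> 'b \<Rightarrow> 'b \<Rightarrow> 'a ^ 3 ^ 3" where
  "T_z \<iota> \<sigma> z = mult_matrix \<iota> (vector [1, \<sigma>, \<sigma>\<^sup>2]) z"

section \<open>Discrete and principal series\<close>

text \<open>\<open>\<iota>\<^sub>2\<close> and \<open>\<iota>\<^sub>3\<close> embed the base field with \<open>q\<close> elements into the fields with \<open>q\<^sup>2\<close> and \<open>q\<^sup>3\<close>
  elements, which are generated by \<open>\<tau>\<close> and \<open>\<sigma>\<close> respectively.\<close>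

definition discrete_series_values ::
    "('k::{field,finite} \<Rightarrow> 'e::field) \<Rightarrow> 'e \<Rightarrow> ('k \<Rightarrow> 'l::field) \<Rightarrow> 'l
      \<Rightarrow> ('l \<Rightarrow> complex) \<Rightarrow> ('k ^ 3 ^ 3 \<Rightarrow> complex) \<Rightarrow> bool" where
  "discrete_series_values \<iota>\<^sub>2 \<tau> \<iota>\<^sub>3 \<sigma> \<psi> \<theta> \<longleftrightarrow>
     (let q = CARD('k); Q = (of_nat q :: complex) in
      (\<forall>a. a \<noteq> 0 \<longrightarrow> \<theta> (T_a a) = (Q - 1) * (Q\<^sup>2 - 1) * \<psi> (\<iota>\<^sub>3 a)) \<and>
      (\<forall>a. a \<noteq> 0 \<longrightarrow> \<theta> (T1_a a) = - (Q - 1) * \<psi> (\<iota>\<^sub>3 a)) \<and>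
      (\<forall>a. a \<noteq> 0 \<longrightarrow> \<theta> (T11_a a) = \<psi> (\<iota>\<^sub>3 a)) \<and>
      (\<forall>a b. a \<noteq> 0 \<and> b \<noteq> 0 \<and> a \<noteq> b \<longrightarrow> \<theta> (T_ab a b) = 0) \<and>
      (\<forall>a b. a \<noteq> 0 \<and> b \<noteq> 0 \<and> a \<noteq> b \<longrightarrow> \<theta> (T1_ab a b) = 0) \<and>
      (\<forall>a b c. a \<noteq> 0 \<and> b \<noteq> 0 \<and> c \<noteq> 0 \<and> distinct [a, b, c] \<longrightarrow> \<theta> (T_abc a b c) = 0) \<and>
      (\<forall>\<kappa> a. \<kappa> \<notin> range \<iota>\<^sub>2 \<and> a \<noteq> 0 \<longrightarrow> \<theta> (T_ka \<iota>\<^sub>2 \<tau> \<kappa> a) = 0) \<and>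
      (\<forall>z. z \<notin> range \<iota>\<^sub>3 \<longrightarrow> \<theta> (T_z \<iota>\<^sub>3 \<sigma> z) = \<psi> z + \<psi> (z ^ q) + \<psi> (z ^ (q\<^sup>2))))"

definition principal_series_values ::
    "('k::{field,finite} \<Rightarrow> 'e::field) \<Rightarrow> 'e \<Rightarrow> ('k \<Rightarrow> 'l::field) \<Rightarrow> 'l
      \<Rightarrow> ('k \<Rightarrow> complex) \<Rightarrow> ('k \<Rightarrow> complex) \<Rightarrow> ('k \<Rightarrow> complex)
      \<Rightarrow> ('k ^ 3 ^ 3 \<Rightarrow> complex) \<Rightarrow> bool" where
  "principal_series_values \<iota>\<^sub>2 \<tau> \<iota>\<^sub>3 \<sigma> \<beta> \<gamma> \<delta> \<theta> \<longleftrightarrow>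
     (let Q = (of_nat CARD('k) :: complex);
          S = (\<lambda>a b. \<beta> a * \<gamma> a * \<delta> b + \<beta> a * \<delta> a * \<gamma> b + \<gamma> a * \<delta> a * \<beta> b) in
      (\<forall>a. a \<noteq> 0 \<longrightarrow> \<theta> (T_a a) = (Q + 1) * (Q\<^sup>2 + Q + 1) * (\<beta> a * \<gamma> a * \<delta> a)) \<and>
      (\<forall>a. a \<noteq> 0 \<longrightarrow> \<theta> (T1_a a) = (2 * Q + 1) * (\<beta> a * \<gamma> a * \<delta> a)) \<and>
      (\<forall>a. a \<noteq> 0 \<longrightarrow> \<theta> (T11_a a) = \<beta> a * \<gamma> a * \<delta> a) \<and>
      (\<forall>a b. a \<noteq> 0 \<and> b \<noteq> 0 \<and> a \<noteq> b \<longrightarrow> \<theta> (T_ab a b) = (Q + 1) * S a b) \<and>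
      (\<forall>a b. a \<noteq> 0 \<and> b \<noteq> 0 \<and> a \<noteq> b \<longrightarrow> \<theta> (T1_ab a b) = S a b) \<and>
      (\<forall>a b c. a \<noteq> 0 \<and> b \<noteq> 0 \<and> c \<noteq> 0 \<and> distinct [a, b, c] \<longrightarrow>
         \<theta> (T_abc a b c) =
           \<beta> a * \<gamma> b * \<delta> c + \<beta> a * \<delta> b * \<gamma> c + \<gamma> a * \<beta> b * \<delta> c +
           \<gamma> a * \<delta> b * \<beta> c + \<delta> a * \<beta> b * \<gamma> c + \<delta> a * \<gamma> b * \<beta> c) \<and>
      (\<forall>\<kappa> a. \<kappa> \<notin> range \<iota>\<^sub>2 \<and> a \<noteq> 0 \<longrightarrow> \<theta> (T_ka \<iota>\<^sub>2 \<tau> \<kappa> a) = 0) \<and>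
      (\<forall>z. z \<notin> range \<iota>\<^sub>3 \<longrightarrow> \<theta> (T_z \<iota>\<^sub>3 \<sigma> z) = 0))"

section \<open>The inducing subgroups and their linear characters\<close>

definition N_grp :: "('a::field ^ 3 ^ 3) set" where
  "N_grp = {mat3 [[1, x, z], [0, 1, y], [0, 0, 1]] | x y z. True}"

definition N1_grp :: "('a::field ^ 3 ^ 3) set" where
  "N1_grp = {mat3 [[1, 0, z], [0, 1, y], [0, 0, 1]] | y z. True}"

definition ZN_grp :: "('a::field ^ 3 ^ 3) set" where
  "ZN_grp = center GL <#>\<^bsub>GL\<^esub> N_grp"

definition ZN1_grp :: "('a::field ^ 3 ^ 3) set" where
  "ZN1_grp = center GL <#>\<^bsub>GL\<^esub> N1_grp"

text \<open>The linear character of \<^const>\<open>ZN_grp\<close>, and by restriction of \<^const>\<open>ZN1_grp\<close>, that sends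
  a scalar matrix \<open>a\<close> times \<open>u\<close> in \<^const>\<open>N_grp\<close> to \<open>\<omega> a * \<phi> (u\<^sub>1\<^sub>2 + u\<^sub>2\<^sub>3)\<close>, in terms of the entries of
  the product; see the lemma below.\<close>

definition central_unipotent_character ::
    "('a::field \<Rightarrow> complex) \<Rightarrow> ('a \<Rightarrow> complex) \<Rightarrow> 'a ^ 3 ^ 3 \<Rightarrow> complex" where
  "central_unipotent_character \<omega> \<phi> M = \<omega> (M $ 1 $ 1) * \<phi> ((M $ 1 $ 2 + M $ 2 $ 3) / M $ 1 $ 1)"

lemma central_unipotent_character_eq:
  assumes "a \<noteq> 0"
  shows "central_unipotent_character \<omega> \<phi> (mat a ** mat3 [[1, x, z], [0, 1, y], [0, 0, 1]])
         = \<omega> a * \<phi> (x + y)"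
  using assms
  by (simp add: central_unipotent_character_def mat3_def mat_def matrix_matrix_mult_def sum_3
      flip: distrib_left)

end

(* Both sides are class functions, so they are compared on representatives of the conjugacy classes.
   The elements of ZN are scalar multiples of unipotent matrices, so the right-hand side
   is supported on the classes of T_a, T1_a and T11_a; on every other class one of the two factors on
   the left vanishes.  On the three remaining classes the induced characters are
   |C(g)| / |H| times the sum of the linear character over the elements of H conjugate to g, and these
   sums reduce to the vanishing of the sum of the nontrivial character phi.

   That the listed matrices represent all classes needs the following: a matrix without eigenvalues
   is similar to a companion matrix, and its irreducible characteristic polynomial of degree n has a
   root in the field with q^n elements because it divides X^(q^n - 1) - 1. *)
theory Submission
  imports Defs "HOL-Computational_Algebra.Polynomial_Factorial"
begin

section \<open>Irreducible polynomials over finite fields\<close>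

text \<open>The split of cases rests on one similarity invariant: whether (A - c)^3 = 0 for some
  scalar c. It holds throughout ZN and is refuted for every other type, so exhausting the types
  suffices and the listed classes never have to be told apart further. The obstacle is that
  \<open>T_ka\<close> and \<open>T_z\<close> refer to prescribed bases through
  \<open>mult_matrix\<close>, a definite description about which nothing follows until 1, \<tau> and
  1, \<sigma>, \<sigma>^2 are known to be bases. The generator hypotheses give this by counting: a
  dependence would produce a proper subring containing the generator. Afterwards the matrix entries
  are avoided altogether: on the coordinate vector of 1, the matrix of multiplication by z satisfies
  the same polynomial relation as z. The constants come from two rules for sums over a class inside
  ZN with fixed scalar a: a nonzero superdiagonal entry contributes -1, a free corner entry
  contributes q. For \<open>T_a\<close>, \<open>T1_a\<close>, \<open>T11_a\<close> the sums are
  therefore 1, -(q+1), q on ZN and 1, -1, 0 on ZN1, times the central character.\<close>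

lemma CARD_field_ge_2: "CARD('a::{field,finite}) \<ge> 2"
proof -
  have "card {0, 1 :: 'a} \<le> CARD('a)" by (rule card_mono) auto
  then show ?thesis by simp
qed

text \<open>Multiplication by \<open>z\<close> permutes the nonzero elements, so it fixes their
  product, which can be cancelled.\<close>

lemma power_card_minus_one_eq_one:
  fixes z :: "'a::{field,finite}"
  assumes "z \<noteq> 0"
  shows "z ^ (CARD('a) - 1) = 1"
proof -
  have "(\<Prod>x\<in>UNIV - {0}. z * x) = \<Prod>(UNIV - {0})"
    by (rule prod.reindex_bij_witness[of _ "\<lambda>x. x / z" "\<lambda>x. z * x"]) (use assms in auto)
  then show ?thesis by (simp add: prod.distrib)
qed

text \<open>Bounding the coefficients rather than the degree makes \<open>n = 0\<close> describe
  exactly the zero polynomial; splitting off the constant term with \<open>pCons\<close> then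
  contributes one factor q per step.\<close>

lemma finite_card_polys_of_bounded_degree:
  "finite {f :: 'a::{field,finite} poly. \<forall>i\<ge>n. coeff f i = 0} \<and>
   card {f :: 'a poly. \<forall>i\<ge>n. coeff f i = 0} = CARD('a) ^ n"
proof (induction n)
  case 0
  have "{f :: 'a poly. \<forall>i. coeff f i = 0} = {0}" by (auto intro: poly_eqI)
  then show ?case by simp
next
  case (Suc n)
  let ?S = "\<lambda>n. {f :: 'a poly. \<forall>i\<ge>n. coeff f i = 0}"
  have "?S (Suc n) = case_prod pCons ` (UNIV \<times> ?S n)"
  proof (intro Set.set_eqI iffI)
    fix f assume f: "f \<in> ?S (Suc n)"
    obtain a g where "f = pCons a g" by (cases f) auto
    with f have "g \<in> ?S n" by (auto simp: coeff_pCons split: nat.splits)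
    with \<open>f = pCons a g\<close> show "f \<in> case_prod pCons ` (UNIV \<times> ?S n)" by auto
  next
    fix f assume "f \<in> case_prod pCons ` (UNIV \<times> ?S n)"
    then show "f \<in> ?S (Suc n)" by (auto simp: coeff_pCons split: nat.splits)
  qed
  moreover have "inj_on (case_prod pCons) (UNIV \<times> ?S n)" by (auto simp: inj_on_def)
  ultimately show ?case using Suc by (simp add: card_image card_cartesian_product)
qed

text \<open>Multiplication by \<open>X\<close> permutes the nonzero residues modulo \<open>p\<close>, so that comparing
  the products of all residues gives Fermat's little theorem in the quotient field.\<close>

lemma irreducible_dvd_monom_minus_one:
  fixes p :: "'a::{field,finite} poly"
  assumes "irreducible p" and n: "degree p = n" "n \<ge> 2"
  shows "p dvd monom 1 (CARD('a) ^ n - 1) - 1"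
proof -
  let ?X = "monom 1 1 :: 'a poly"
  define S where "S = {f :: 'a poly. \<forall>i\<ge>n. coeff f i = 0} - {0}"
  have p0: "p \<noteq> 0" using n by auto
  have pr: "prime_elem p" using assms(1) by (rule field_poly_irreducible_imp_prime)
  have fin: "finite S" and card: "card S = CARD('a) ^ n - 1"
    using finite_card_polys_of_bounded_degree[where ?'a='a, of n]
    unfolding S_def by (auto simp: card_Diff_singleton_if)
  have S: "f \<in> S \<longleftrightarrow> f \<noteq> 0 \<and> degree f < n" for f
    unfolding S_def using n by (auto simp: coeff_eq_0 intro: degree_lessI)
  have ndvd: "\<not> p dvd f" if "f \<in> S" for f
    using that S n dvd_imp_degree_le[of p f] by auto
  \<comment> \<open>This is where n \<ge> 2 enters: X has degree 1 < n, so it is itself a nonzero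
    residue and hence a unit modulo \<open>p\<close>.\<close>
  have X: "\<not> p dvd ?X" using ndvd[of ?X] S[of ?X] n by (auto simp: degree_monom_eq)
  define m where "m f = (?X * f) mod p" for f
  have mS: "m f \<in> S" if "f \<in> S" for f
  proof -
    have "m f \<noteq> 0" using ndvd[OF that] X pr
      unfolding m_def by (metis dvd_eq_mod_eq_0 prime_elem_dvd_multD)
    then show ?thesis using S degree_mod_less[OF p0, of "?X * f"] n unfolding m_def by auto
  qed
  have inj: "inj_on m S"
  proof (rule inj_onI)
    fix f g assume fg: "f \<in> S" "g \<in> S" "m f = m g"
    then have "p dvd ?X * (f - g)"
      unfolding m_def by (metis mod_eq_dvd_iff right_diff_distrib)
    then have d: "p dvd f - g" using X pr prime_elem_dvd_multD by blast
    have "degree (f - g) < n" using fg S degree_diff_less[of f n g] by auto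
    with d show "f = g" using dvd_imp_degree_le[of p "f - g"] n by force
  qed
  have bij: "bij_betw m S S"
    using inj mS fin by (simp add: bij_betw_def endo_inj_surj image_subset_iff)
  have "(\<Prod>f\<in>S. ?X * f) mod p = (\<Prod>f\<in>S. m f) mod p"
    unfolding m_def by (rule mod_prod_eq[symmetric])
  also have "(\<Prod>f\<in>S. m f) = (\<Prod>f\<in>S. f)"
    by (rule prod.reindex_bij_betw[OF bij])
  finally have "p dvd (\<Prod>f\<in>S. ?X * f) - \<Prod>S" by (simp add: mod_eq_dvd_iff)
  also have "(\<Prod>f\<in>S. ?X * f) - \<Prod>S = (monom 1 (card S) - 1) * \<Prod>S"
    by (simp add: prod.distrib monom_power left_diff_distrib)
  finally have "p dvd monom 1 (card S) - 1 \<or> p dvd \<Prod>S" using pr prime_elem_dvd_multD by blast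
  moreover have "\<not> p dvd \<Prod>S" using fin ndvd
  proof (induction S rule: finite_induct)
    case empty
    then show ?case using pr by (simp add: prime_elem_def)
  next
    case (insert f F)
    then show ?case using pr by (auto simp: prime_elem_dvd_mult_iff)
  qed
  ultimately show ?thesis using card by simp
qed

section \<open>Embeddings of fields and roots in extensions of degree two and three\<close>

lemma field_embedding_simps:
  fixes \<iota> :: "'a::field \<Rightarrow> 'b::field"
  assumes "field_embedding \<iota>"
  shows "\<iota> 1 = 1" "\<iota> (x + y) = \<iota> x + \<iota> y" "\<iota> (x * y) = \<iota> x * \<iota> y" "\<iota> 0 = 0"
    "\<iota> (- x) = - \<iota> x" "\<iota> (x - y) = \<iota> x - \<iota> y" "\<iota> (sum f A) = (\<Sum>i\<in>A. \<iota> (f i))"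
proof -
  show *: "\<iota> 1 = 1" "\<iota> (x + y) = \<iota> x + \<iota> y" "\<iota> (x * y) = \<iota> x * \<iota> y" for x y
    using assms by (auto simp: field_embedding_def)
  show 0: "\<iota> 0 = 0" using *(2)[of 0 0] by (metis add.right_neutral add_left_cancel)
  show m: "\<iota> (- x) = - \<iota> x" for x using *(2)[of x "- x"] 0 by (simp add: eq_neg_iff_add_eq_0 add.commute)
  show "\<iota> (x - y) = \<iota> x - \<iota> y" using *(2)[of x "- y"] m by simp
  show "\<iota> (sum f A) = (\<Sum>i\<in>A. \<iota> (f i))"
    by (induction A rule: infinite_finite_induct) (auto simp: 0 *)
qed

lemma field_embedding_eq_iff:
  assumes "field_embedding \<iota>" shows "\<iota> x = \<iota> y \<longleftrightarrow> x = y"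
proof
  assume "\<iota> x = \<iota> y"
  then have "\<iota> (x - y) = 0" by (simp add: field_embedding_simps[OF assms])
  then have "x - y = 0"
    using field_embedding_simps(1,3)[OF assms] by (metis mult_zero_left right_inverse zero_neq_one)
  then show "x = y" by simp
qed simp

lemma map_poly_field_embedding_mult:
  assumes "field_embedding \<iota>"
  shows "map_poly \<iota> (p * r) = map_poly \<iota> p * map_poly \<iota> r"
  by (rule poly_eqI)
    (simp add: coeff_map_poly coeff_mult field_embedding_simps[OF assms])

text \<open>Every nonzero element of the large field is a root of X^N - 1 = p h with N = q^n - 1. If
  \<open>p\<close> had no root there, all N of them would be roots of \<open>h\<close>, whose degree
  is only N - n.\<close>

lemma irreducible_has_root_in_extension:
  fixes p :: "'a::{field,finite} poly" and \<iota> :: "'a \<Rightarrow> 'b::{field,finite}"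
  assumes \<iota>: "field_embedding \<iota>" and "irreducible p" and n: "degree p = n" "n \<ge> 2"
    and K: "CARD('b) = CARD('a) ^ n"
  obtains z where "poly (map_poly \<iota> p) z = 0"
proof -
  let ?N = "CARD('a) ^ n - 1"
  let ?U = "monom 1 ?N - 1 :: 'a poly"
  obtain h where h: "?U = p * h"
    using irreducible_dvd_monom_minus_one[OF assms(2) n] by (auto simp: dvd_def)
  have "CARD('a) \<ge> 2" by (rule CARD_field_ge_2)
  then have "CARD('a) ^ n > 1" using n by (intro one_less_power) auto
  then have N: "?N > 0" by simp
  have degU: "degree ?U = ?N"
    using N degree_add_eq_left[of "- 1" "monom 1 ?N :: 'a poly"] by (simp add: degree_monom_eq)
  have p0: "p \<noteq> 0" using n by auto
  have degh: "degree h + n = ?N" and h0: "h \<noteq> 0"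
  proof -
    show "h \<noteq> 0" using h degU N by auto
    then show "degree h + n = ?N" using h degU n p0 degree_mult_eq[of p h] by simp
  qed
  show ?thesis
  proof (rule ccontr)
    assume "\<not> thesis"
    then have no: "poly (map_poly \<iota> p) z \<noteq> 0" for z using that by blast
    have root: "poly (map_poly \<iota> h) z = 0" if "z \<noteq> 0" for z
    proof -
      have "z ^ ?N = 1" using power_card_minus_one_eq_one[OF that] K by simp
      moreover have "map_poly \<iota> ?U = monom 1 ?N - 1"
        by (rule poly_eqI) (auto simp: coeff_map_poly field_embedding_simps[OF \<iota>] coeff_1)
      ultimately have "poly (map_poly \<iota> ?U) z = 0" by (simp add: poly_monom)
      then show ?thesis unfolding h map_poly_field_embedding_mult[OF \<iota>] using no by simp
    qed
    have deg: "degree (map_poly \<iota> h) = degree h"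
      by (rule degree_map_poly) (metis \<iota> field_embedding_eq_iff field_embedding_simps(4))
    have nz: "map_poly \<iota> h \<noteq> 0"
      using h0 by (metis \<iota> coeff_0 coeff_map_poly field_embedding_eq_iff field_embedding_simps(4) poly_eqI)
    have "card (UNIV - {0::'b}) \<le> card {z. poly (map_poly \<iota> h) z = 0}"
      using root nz by (intro card_mono poly_roots_finite) auto
    also have "\<dots> \<le> degree h" using card_poly_roots_bound[OF nz] deg by simp
    finally show False using K N degh n by simp
  qed
qed

text \<open>In degree at most 3 a factorization into nonunits must contain a linear factor, and over
  a field that factor has a root.\<close>

lemma irreducible_of_no_root:
  fixes p :: "'a::field poly"
  assumes deg: "2 \<le> degree p" "degree p \<le> 3" and no: "\<And>x. poly p x \<noteq> 0"
  shows "irreducible p"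
proof (rule irreducibleI)
  show "p \<noteq> 0" using deg by auto
  then show "\<not> is_unit p" using deg by (auto simp: is_unit_iff_degree)
next
  fix a b assume p: "p = a * b"
  show "is_unit a \<or> is_unit b"
  proof (rule ccontr)
    assume nu: "\<not> (is_unit a \<or> is_unit b)"
    have nz: "a \<noteq> 0" "b \<noteq> 0" using p deg by auto
    then have "degree a \<ge> 1" "degree b \<ge> 1" using nu is_unit_iff_degree[of a] is_unit_iff_degree[of b] by auto
    moreover have "degree a + degree b \<le> 3" using deg p degree_mult_eq[OF nz] by simp
    ultimately have "degree a = 1 \<or> degree b = 1" by linarith
    then obtain u v where "v \<noteq> 0" "a = [:u, v:] \<or> b = [:u, v:]"
      using degree1_coeffs by metis
    then have "poly p (- u / v) = 0" unfolding p by auto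
    with no show False by blast
  qed
qed

text \<open>The signs follow the last column of a companion matrix, so that the relation can be
  compared directly with the action of such a matrix.\<close>

lemma quadratic_root_in_extension:
  fixes \<iota> :: "'a::{field,finite} \<Rightarrow> 'b::{field,finite}"
  assumes \<iota>: "field_embedding \<iota>" and K: "CARD('b) = CARD('a) ^ 2"
    and no: "\<And>x. x\<^sup>2 \<noteq> c0 + c1 * x"
  obtains z where "z\<^sup>2 = \<iota> c0 + \<iota> c1 * z"
proof -
  let ?p = "[:- c0, - c1, 1:]"
  have "irreducible ?p"
  proof (rule irreducible_of_no_root)
    fix x show "poly ?p x \<noteq> 0" using no[of x] by (auto simp: algebra_simps power2_eq_square)
  qed auto
  then obtain z where "poly (map_poly \<iota> ?p) z = 0"
    using irreducible_has_root_in_extension[OF \<iota>, of ?p 2] K by auto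
  then have "z\<^sup>2 = \<iota> c0 + \<iota> c1 * z"
    by (simp add: map_poly_pCons field_embedding_simps[OF \<iota>] algebra_simps power2_eq_square)
  then show ?thesis by (rule that)
qed

lemma cubic_root_in_extension:
  fixes \<iota> :: "'a::{field,finite} \<Rightarrow> 'b::{field,finite}"
  assumes \<iota>: "field_embedding \<iota>" and K: "CARD('b) = CARD('a) ^ 3"
    and no: "\<And>x. x ^ 3 \<noteq> c0 + c1 * x + c2 * x\<^sup>2"
  obtains z where "z ^ 3 = \<iota> c0 + \<iota> c1 * z + \<iota> c2 * z\<^sup>2"
proof -
  let ?p = "[:- c0, - c1, - c2, 1:]"
  have "irreducible ?p"
  proof (rule irreducible_of_no_root)
    fix x show "poly ?p x \<noteq> 0"
      using no[of x] by (auto simp: algebra_simps power2_eq_square power3_eq_cube)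
  qed auto
  then obtain z where "poly (map_poly \<iota> ?p) z = 0"
    using irreducible_has_root_in_extension[OF \<iota>, of ?p 3] K by auto
  then have "z ^ 3 = \<iota> c0 + \<iota> c1 * z + \<iota> c2 * z\<^sup>2"
    by (simp add: map_poly_pCons field_embedding_simps[OF \<iota>] algebra_simps power2_eq_square
        power3_eq_cube)
  then show ?thesis by (rule that)
qed

section \<open>Extensions generated by one element and their bases\<close>

lemma is_subfield_of_finite_subring:
  fixes S :: "'a::{field,finite} set"
  assumes "1 \<in> S" and diff: "\<And>x y. x \<in> S \<Longrightarrow> y \<in> S \<Longrightarrow> x - y \<in> S"
    and mult: "\<And>x y. x \<in> S \<Longrightarrow> y \<in> S \<Longrightarrow> x * y \<in> S"
  shows "is_subfield S"
proof -
  have "inverse x \<in> S" if "x \<in> S" for x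
  proof (cases "x = 0")
    case False
    \<comment> \<open>In a finite field the inverse of a nonzero \<open>x\<close> is the power
      x^(q-2), where q is the size of this field, so closure under products already yields
      inverses.\<close>
    have "CARD('a) \<ge> 2" by (rule CARD_field_ge_2)
    then have "Suc (CARD('a) - 2) = CARD('a) - 1" by simp
    then have "x * x ^ (CARD('a) - 2) = 1"
      using power_card_minus_one_eq_one[OF False] by (metis power_Suc)
    then have "inverse x = x ^ (CARD('a) - 2)" by (rule inverse_unique)
    moreover have "x ^ n \<in> S" for n by (induction n) (use assms that in auto)
    ultimately show ?thesis by simp
  qed (use that in simp)
  then show ?thesis using assms by (auto simp: is_subfield_def)
qed

text \<open>Turns the hull into a closure principle: a subring found to contain the generator must
  be everything, which contradicts its size whenever it is too small.\<close>

lemma generator_over_imp_UNIV: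
  fixes S :: "'b::{field,finite} set"
  assumes "generator_over \<iota> t" and "t \<in> S" and "range \<iota> \<subseteq> S" and "1 \<in> S"
    and "\<And>x y. x \<in> S \<Longrightarrow> y \<in> S \<Longrightarrow> x - y \<in> S"
    and "\<And>x y. x \<in> S \<Longrightarrow> y \<in> S \<Longrightarrow> x * y \<in> S"
  shows "S = UNIV"
proof -
  have "is_subfield S" using assms(4-6) by (rule is_subfield_of_finite_subring)
  then have "is_subfield hull (insert t (range \<iota>)) \<subseteq> S"
    using assms(2,3) by (intro hull_minimal) auto
  with assms(1) show ?thesis by (auto simp: generator_over_def)
qed

lemma power_CARD_field_less: "m < n \<Longrightarrow> CARD('a::{field,finite}) ^ m < CARD('a) ^ n"
  using CARD_field_ge_2[where 'a = 'a] by (intro power_strict_increasing) auto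

text \<open>The linear map from coordinates to field elements. Through it, identities between
  multiplication matrices applied to vectors become arithmetic in the field.\<close>

definition from_coords :: "('a::field \<Rightarrow> 'b::field) \<Rightarrow> 'b ^ 'n \<Rightarrow> 'a ^ 'n \<Rightarrow> 'b" where
  "from_coords \<iota> B v = (\<Sum>i\<in>UNIV. \<iota> (v $ i) * B $ i)"

lemma inj_from_coords:
  assumes \<iota>: "field_embedding \<iota>" and ker: "\<And>v. from_coords \<iota> B v = 0 \<Longrightarrow> v = 0"
  shows "inj (from_coords \<iota> B)"
proof (rule injI)
  fix v w assume "from_coords \<iota> B v = from_coords \<iota> B w"
  then have "from_coords \<iota> B (v - w) = 0"
    by (simp add: from_coords_def field_embedding_simps[OF \<iota>] left_diff_distrib sum_subtractf)
  then show "v = w" using ker by force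
qed

text \<open>Linear independence alone suffices because source and target have the same finite
  size.\<close>

lemma bij_from_coords:
  fixes B :: "'b::{field,finite} ^ 'n" and \<iota> :: "'a::{field,finite} \<Rightarrow> 'b"
  assumes "field_embedding \<iota>" and "\<And>v. from_coords \<iota> B v = 0 \<Longrightarrow> v = 0"
    and K: "CARD('b) = CARD('a) ^ CARD('n)"
  shows "bij (from_coords \<iota> B)"
proof -
  have inj: "inj (from_coords \<iota> B)" using assms(1,2) by (rule inj_from_coords)
  then have "card (range (from_coords \<iota> B)) = CARD('b)" using K by (simp add: card_image)
  then have "range (from_coords \<iota> B) = UNIV" by (intro card_subset_eq) auto
  with inj show ?thesis by (simp add: bij_def)
qed

lemma quadratic_basis:
  fixes \<iota> :: "'a::{field,finite} \<Rightarrow> 'b::{field,finite}"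
  assumes \<iota>: "field_embedding \<iota>" and gen: "generator_over \<iota> \<tau>" and K: "CARD('b) = CARD('a) ^ 2"
  shows "bij (from_coords \<iota> (vector [1, \<tau>] :: 'b ^ 2))"
proof (rule bij_from_coords[OF \<iota>])
  fix v :: "'a ^ 2" assume "from_coords \<iota> (vector [1, \<tau>]) v = 0"
  then have 0: "\<iota> (v $ 1) + \<iota> (v $ 2) * \<tau> = 0" by (simp add: from_coords_def sum_2)
  have "\<tau> \<notin> range \<iota>"
  proof
    assume "\<tau> \<in> range \<iota>"
    then have "range \<iota> = UNIV"
      by (intro generator_over_imp_UNIV[OF gen])
        (auto simp flip: field_embedding_simps[OF \<iota>])
    then have "CARD('b) \<le> CARD('a)" by (metis card_image_le finite)
    with K power_CARD_field_less[where 'a = 'a, of 1 2] show False by simp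
  qed
  have v2: "v $ 2 = 0"
  proof (rule ccontr)
    assume "v $ 2 \<noteq> 0"
    then have "\<iota> (v $ 2) * \<iota> (inverse (v $ 2)) = 1"
      by (simp flip: field_embedding_simps[OF \<iota>])
    from this have "\<tau> = \<iota> (- (v $ 1 * inverse (v $ 2)))"
      unfolding field_embedding_simps[OF \<iota>] using 0 by algebra
    with \<open>\<tau> \<notin> range \<iota>\<close> show False by blast
  qed
  with 0 have "\<iota> (v $ 1) = \<iota> 0" by (simp add: field_embedding_simps[OF \<iota>])
  with v2 show "v = 0" by (simp add: vec_eq_iff forall_2 field_embedding_eq_iff[OF \<iota>])
qed (use K in simp)

lemma cubic_basis:
  fixes \<iota> :: "'a::{field,finite} \<Rightarrow> 'b::{field,finite}"
  assumes \<iota>: "field_embedding \<iota>" and gen: "generator_over \<iota> \<sigma>" and K: "CARD('b) = CARD('a) ^ 3"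
  shows "bij (from_coords \<iota> (vector [1, \<sigma>, \<sigma>\<^sup>2] :: 'b ^ 3))"
proof (rule bij_from_coords[OF \<iota>])
  note \<iota>s = field_embedding_simps[OF \<iota>]
  fix v :: "'a ^ 3" assume "from_coords \<iota> (vector [1, \<sigma>, \<sigma>\<^sup>2]) v = 0"
  then have 0: "\<iota> (v $ 1) + \<iota> (v $ 2) * \<sigma> + \<iota> (v $ 3) * \<sigma>\<^sup>2 = 0"
    by (simp add: from_coords_def sum_3)
  have inv: "\<iota> x * \<iota> (inverse x) = 1" if "x \<noteq> 0" for x
    using that by (simp flip: \<iota>s)
  \<comment> \<open>A quadratic relation would make the elements x + y \<sigma> a subring containing
    the generator, but there are at most q^2 of them and the field has q^3.\<close>
  have no: "\<sigma>\<^sup>2 \<noteq> \<iota> c + \<iota> d * \<sigma>" for c d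
  proof
    assume \<sigma>: "\<sigma>\<^sup>2 = \<iota> c + \<iota> d * \<sigma>"
    let ?f = "\<lambda>(x, y). \<iota> x + \<iota> y * \<sigma>"
    have mem: "\<iota> x + \<iota> y * \<sigma> \<in> range ?f" for x y by auto
    have "range ?f = UNIV"
    proof (rule generator_over_imp_UNIV[OF gen])
      show "\<sigma> \<in> range ?f" using mem[of 0 1] by (simp add: \<iota>s)
      show "range \<iota> \<subseteq> range ?f" using mem[of _ 0] by (auto simp: \<iota>s)
      show "1 \<in> range ?f" using mem[of 1 0] by (simp add: \<iota>s)
    next
      fix x y assume "x \<in> range ?f" "y \<in> range ?f"
      then obtain a b a' b' where xy: "x = \<iota> a + \<iota> b * \<sigma>" "y = \<iota> a' + \<iota> b' * \<sigma>" by auto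
      show "x - y \<in> range ?f"
        using mem[of "a - a'" "b - b'"] by (simp add: xy \<iota>s algebra_simps)
      have "x * y = \<iota> (a * a' + b * b' * c) + \<iota> (a * b' + b * a' + b * b' * d) * \<sigma>"
        unfolding \<iota>s xy using \<sigma> by algebra
      then show "x * y \<in> range ?f" using mem by simp
    qed
    then have "CARD('b) \<le> CARD('a \<times> 'a)" by (metis card_image_le finite)
    with K power_CARD_field_less[where 'a = 'a, of 2 3] show False
      by (simp add: power2_eq_square)
  qed
  have v3: "v $ 3 = 0"
  proof (rule ccontr)
    assume "v $ 3 \<noteq> 0"
    from inv[OF this] have "\<sigma>\<^sup>2 = \<iota> (- (v $ 1 * inverse (v $ 3))) + \<iota> (- (v $ 2 * inverse (v $ 3))) * \<sigma>"
      unfolding \<iota>s using 0 by algebra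
    with no show False by blast
  qed
  have v2: "v $ 2 = 0"
  proof (rule ccontr)
    assume "v $ 2 \<noteq> 0"
    \<comment> \<open>Here \<sigma> would lie in the base field. Squaring presents this as a
      quadratic relation with linear coefficient 0, so the same exclusion \<open>no\<close>
      applies.\<close>
    from inv[OF this] have "\<sigma>\<^sup>2 = \<iota> ((v $ 1 * inverse (v $ 2)) * (v $ 1 * inverse (v $ 2))) + \<iota> 0 * \<sigma>"
      using 0 unfolding v3 \<iota>s by algebra
    with no show False by blast
  qed
  from 0 v2 v3 have "\<iota> (v $ 1) = \<iota> 0" by (simp add: \<iota>s)
  with v2 v3 show "v = 0" by (simp add: vec_eq_iff forall_3 field_embedding_eq_iff[OF \<iota>])
qed (use K in simp)

text \<open>Bijectivity gives both existence and uniqueness for the definite description in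
  \<open>mult_matrix\<close>: column j must consist of the coordinates of the product of
  \<open>w\<close> with the j-th basis element.\<close>

lemma from_coords_mult_matrix:
  fixes B :: "'b::field ^ 'n" and \<iota> :: "'a::field \<Rightarrow> 'b"
  assumes \<iota>: "field_embedding \<iota>" and bij: "bij (from_coords \<iota> B)"
  shows "from_coords \<iota> B (mult_matrix \<iota> B w *v v) = w * from_coords \<iota> B v"
proof -
  let ?M = "mult_matrix \<iota> B w"
  let ?P = "\<lambda>M. \<forall>j. w * B $ j = (\<Sum>i\<in>UNIV. \<iota> (M $ i $ j) * B $ i)"
  have col: "(\<Sum>i\<in>UNIV. \<iota> (M $ i $ j) * B $ i) = from_coords \<iota> B (column j M)" for M j
    by (simp add: from_coords_def column_def)
  define M0 :: "'a ^ 'n ^ 'n" where "M0 = (\<chi> i j. inv_into UNIV (from_coords \<iota> B) (w * B $ j) $ i)"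
  have cM0: "column j M0 = inv_into UNIV (from_coords \<iota> B) (w * B $ j)" for j
    by (simp add: M0_def column_def vec_eq_iff)
  have M0: "?P M0" unfolding col cM0 using bij by (simp add: bij_is_surj surj_f_inv_f)
  have "?M = M0" unfolding mult_matrix_def
  proof (rule the_equality[of ?P, OF M0])
    fix M assume "?P M"
    then have "from_coords \<iota> B (column j M) = from_coords \<iota> B (column j M0)" for j
      using M0 unfolding col by metis
    then have "column j M = column j M0" for j using bij by (meson bij_is_inj injD)
    then show "M = M0" by (simp add: column_def vec_eq_iff)
  qed
  then have M: "w * B $ j = (\<Sum>i\<in>UNIV. \<iota> (?M $ i $ j) * B $ i)" for j using M0 by metis
  have "from_coords \<iota> B (?M *v v) = (\<Sum>i\<in>UNIV. \<Sum>j\<in>UNIV. \<iota> (?M $ i $ j) * \<iota> (v $ j) * B $ i)"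
    by (simp add: from_coords_def matrix_vector_mult_def field_embedding_simps[OF \<iota>] sum_distrib_right)
  also have "\<dots> = (\<Sum>j\<in>UNIV. \<iota> (v $ j) * (\<Sum>i\<in>UNIV. \<iota> (?M $ i $ j) * B $ i))"
    by (subst sum.swap) (simp add: sum_distrib_left mult_ac)
  also have "\<dots> = w * from_coords \<iota> B v"
    by (simp add: from_coords_def M[symmetric] sum_distrib_left) (simp add: mult_ac)
  finally show ?thesis .
qed

section \<open>Similarity of matrices\<close>

lemma mat3_nth [simp]:
  "mat3 [[a, b, c], [d, e, f], [g, h, i]] $ 1 $ 1 = a"
  "mat3 [[a, b, c], [d, e, f], [g, h, i]] $ 1 $ 2 = b"
  "mat3 [[a, b, c], [d, e, f], [g, h, i]] $ 1 $ 3 = c"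
  "mat3 [[a, b, c], [d, e, f], [g, h, i]] $ 2 $ 1 = d"
  "mat3 [[a, b, c], [d, e, f], [g, h, i]] $ 2 $ 2 = e"
  "mat3 [[a, b, c], [d, e, f], [g, h, i]] $ 2 $ 3 = f"
  "mat3 [[a, b, c], [d, e, f], [g, h, i]] $ 3 $ 1 = g"
  "mat3 [[a, b, c], [d, e, f], [g, h, i]] $ 3 $ 2 = h"
  "mat3 [[a, b, c], [d, e, f], [g, h, i]] $ 3 $ 3 = i"
  by (simp_all add: mat3_def)

lemma mat3_eta:
  "A = mat3 [[A $ 1 $ 1, A $ 1 $ 2, A $ 1 $ 3], [A $ 2 $ 1, A $ 2 $ 2, A $ 2 $ 3],
             [A $ 3 $ 1, A $ 3 $ 2, A $ 3 $ 3]]"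
  by (simp add: vec_eq_iff forall_3)

lemma mat3_cases:
  obtains a b c d e f g h i where "A = mat3 [[a, b, c], [d, e, f], [g, h, i]]"
  using mat3_eta by metis

lemma mat3_eq_iff:
  "mat3 [[a, b, c], [d, e, f], [g, h, i]] = mat3 [[a', b', c'], [d', e', f'], [g', h', i']] \<longleftrightarrow>
   a = a' \<and> b = b' \<and> c = c' \<and> d = d' \<and> e = e' \<and> f = f' \<and> g = g' \<and> h = h' \<and> i = i'"
  by (auto simp: vec_eq_iff forall_3)

lemma mat3_mult:
  "mat3 [[a, b, c], [d, e, f], [g, h, i]] ** mat3 [[a', b', c'], [d', e', f'], [g', h', i']] =
   mat3 [[a * a' + b * d' + c * g', a * b' + b * e' + c * h', a * c' + b * f' + c * i'],
         [d * a' + e * d' + f * g', d * b' + e * e' + f * h', d * c' + e * f' + f * i'],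
         [g * a' + h * d' + i * g', g * b' + h * e' + i * h', g * c' + h * f' + i * i']]"
  by (simp add: vec_eq_iff forall_3 matrix_matrix_mult_def sum_3)

lemma mat_eq_mat3: "mat a = mat3 [[a, 0, 0], [0, a, 0], [0, 0, a]]"
  by (simp add: vec_eq_iff forall_3 mat_def)

lemma mat3_diff:
  "mat3 [[a, b, c], [d, e, f], [g, h, i]] - mat3 [[a', b', c'], [d', e', f'], [g', h', i']] =
   mat3 [[a - a', b - b', c - c'], [d - d', e - e', f - f'], [g - g', h - h', i - i']]"
  by (simp add: vec_eq_iff forall_3)

lemma det_mat3:
  "det (mat3 [[a, b, c], [d, e, f], [g, h, i]]) =
   a * e * i + b * f * g + c * d * h - a * f * h - b * d * i - c * e * g"
  by (simp add: det_3)

section \<open>Similarity and its invariants\<close>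

lemma det_eq_0_imp_kernel:
  fixes A :: "'a::field ^ 'n ^ 'n"
  assumes "det A = 0"
  obtains v where "v \<noteq> 0" "A *v v = 0"
  using assms by (metis invertible_det_nz invertible_left_inverse matrix_left_invertible_ker)

text \<open>Written without the inverse of P, so that an explicit witness needs only a nonzero
  determinant and polynomial identities between entries.\<close>

definition similar :: "'a::field ^ 'n ^ 'n \<Rightarrow> 'a ^ 'n ^ 'n \<Rightarrow> bool" where
  "similar A B \<longleftrightarrow> (\<exists>P. invertible P \<and> A ** P = P ** B)"

lemma similarI: "det P \<noteq> 0 \<Longrightarrow> A ** P = P ** B \<Longrightarrow> similar A B"
  unfolding similar_def using invertible_det_nz by blast

lemma similar_refl: "similar A A"
  by (rule similarI[of "mat 1"]) auto

lemma similar_sym: "similar A B \<Longrightarrow> similar B A"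
proof -
  assume "similar A B"
  then obtain P where P: "invertible P" "A ** P = P ** B" by (auto simp: similar_def)
  then obtain Q where Q: "P ** Q = mat 1" "Q ** P = mat 1" by (auto simp: invertible_def)
  have "B ** Q = Q ** (P ** B) ** Q" by (simp add: matrix_mul_assoc Q)
  also have "\<dots> = Q ** A ** (P ** Q)" by (simp add: P(2)[symmetric] matrix_mul_assoc)
  finally have "B ** Q = Q ** A" by (simp add: Q)
  moreover have "invertible Q" using Q by (auto simp: invertible_def)
  ultimately show ?thesis by (auto simp: similar_def)
qed

lemma similar_trans: "similar A B \<Longrightarrow> similar B C \<Longrightarrow> similar A C"
  unfolding similar_def by (metis invertible_mult matrix_mul_assoc)

lemma det_similar: "similar A B \<Longrightarrow> det A = det B"
  unfolding similar_def by (metis det_mul invertible_det_nz mult.commute mult_cancel_left)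

lemma mat_commute: "mat a ** A = A ** mat a" for A :: "'a::field ^ 'n ^ 'n"
  by (simp add: vec_eq_iff matrix_matrix_mult_def mat_def if_distrib if_distribR cong: if_cong)

text \<open>Scalar matrices commute with P. Consequently all values of the characteristic
  polynomial, and nilpotency of A - c, are similarity invariants.\<close>

lemma similar_diff_mat:
  assumes "similar A B"
  shows "similar (A - mat c) (B - mat c)"
proof -
  obtain P where P: "invertible P" "A ** P = P ** B" using assms by (auto simp: similar_def)
  have "mat c ** P = P ** mat c" by (rule mat_commute)
  then have "(A - mat c) ** P = P ** (B - mat c)"
    using P(2) by (simp add: vec_eq_iff matrix_matrix_mult_def left_diff_distrib
        right_diff_distrib sum_subtractf)
  with P(1) show ?thesis by (auto simp: similar_def)
qed

lemmas det_diff_mat_similar = det_similar[OF similar_diff_mat]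

section \<open>Normal forms of upper triangular matrices\<close>

lemma similar_swap_first:
  assumes "a \<noteq> b"
  shows "\<exists>x' z' y'. similar (mat3 [[a, x, z], [0, b, y], [0, 0, c]])
    (mat3 [[b, x', z'], [0, a, y'], [0, 0, c]])"
proof -
  let ?w = "y / (b - a)"
  have w: "(b - a) * ?w = y" using assms by simp
  \<comment> \<open>The first column (x, b - a, 0) of the witness is an eigenvector for b and the
    second, e1, is one for a.\<close>
  have "similar (mat3 [[a, x, z], [0, b, y], [0, 0, c]])
      (mat3 [[b, 0, ?w], [0, a, z - x * ?w], [0, 0, c]])"
    by (rule similarI[of "mat3 [[x, 1, 0], [b - a, 0, 0], [0, 0, 1]]"])
      (use assms w in \<open>simp_all add: det_mat3 mat3_mult mat3_eq_iff, simp_all add: algebra_simps\<close>)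
  then show ?thesis by blast
qed

lemma similar_swap_last:
  assumes "b \<noteq> c"
  shows "\<exists>x' z' y'. similar (mat3 [[a, x, z], [0, b, y], [0, 0, c]])
    (mat3 [[a, x', z'], [0, c, y'], [0, 0, b]])"
proof -
  \<comment> \<open>The second column (0, y, c - b) of the witness is, modulo e1, an eigenvector for
    c; the third is e2.\<close>
  have "similar (mat3 [[a, x, z], [0, b, y], [0, 0, c]])
      (mat3 [[a, x * y + z * (c - b), x], [0, c, 0], [0, 0, b]])"
    by (rule similarI[of "mat3 [[1, 0, 0], [0, y, 1], [0, c - b, 0]]"])
      (use assms in \<open>simp_all add: det_mat3 mat3_mult mat3_eq_iff algebra_simps\<close>)
  then show ?thesis by blast
qed

lemma similar_upper_triangular_aab:
  assumes "a \<noteq> c"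
  shows "similar (mat3 [[a, x, z], [0, a, y], [0, 0, c]]) (T_ab a c) \<or>
         similar (mat3 [[a, x, z], [0, a, y], [0, 0, c]]) (T1_ab a c)"
proof -
  \<comment> \<open>The vector (u, w, 1) is the eigenvector for c, found by back substitution. When
    x is nonzero, scaling e1 by x normalizes the Jordan block, since e2 is sent to x e1 + a
    e2.\<close>
  let ?w = "y / (c - a)"
  let ?u = "(x * ?w + z) / (c - a)"
  have "(c - a) * ?w = y" "(c - a) * ?u = x * ?w + z" using assms by simp_all
  then have w: "y + a * ?w = c * ?w" and u: "z + x * ?w + a * ?u = c * ?u"
    by (simp_all only: left_diff_distrib diff_eq_eq) (simp_all add: ac_simps)
  show ?thesis
  proof (cases "x = 0")
    case True
    have "similar (mat3 [[a, x, z], [0, a, y], [0, 0, c]]) (T_ab a c)"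
      by (rule similarI[of "mat3 [[1, 0, ?u], [0, 1, ?w], [0, 0, 1]]"])
        (use True u w in \<open>simp_all add: T_ab_def det_mat3 mat3_mult mat3_eq_iff ac_simps\<close>)
    then show ?thesis ..
  next
    case False
    have "similar (mat3 [[a, x, z], [0, a, y], [0, 0, c]]) (T1_ab a c)"
      by (rule similarI[of "mat3 [[x, 0, ?u], [0, 1, ?w], [0, 0, 1]]"])
        (use False u w in \<open>simp_all add: T1_ab_def det_mat3 mat3_mult mat3_eq_iff ac_simps\<close>)
    then show ?thesis ..
  qed
qed

lemma similar_upper_triangular_abc:
  assumes "a \<noteq> b" "a \<noteq> c" "b \<noteq> c"
  shows "similar (mat3 [[a, x, z], [0, b, y], [0, 0, c]]) (T_abc a b c)"
proof -
  \<comment> \<open>Back substitution again: (v, 1, 0) and (u, w, 1) are eigenvectors for b and c,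
    and with e1 they form the columns of the witness.\<close>
  let ?v = "x / (b - a)" and ?w = "y / (c - b)"
  let ?u = "(x * ?w + z) / (c - a)"
  have "(b - a) * ?v = x" "(c - b) * ?w = y" "(c - a) * ?u = x * ?w + z" using assms by simp_all
  then have v: "x + a * ?v = b * ?v" and w: "y + b * ?w = c * ?w"
    and u: "z + x * ?w + a * ?u = c * ?u"
    by (simp_all only: left_diff_distrib diff_eq_eq) (simp_all add: ac_simps)
  show ?thesis
    by (rule similarI[of "mat3 [[1, ?v, ?u], [0, 1, ?w], [0, 0, 1]]"])
      (use u v w in \<open>simp_all add: T_abc_def det_mat3 mat3_mult mat3_eq_iff ac_simps\<close>)
qed

text \<open>With N the strictly upper triangular part, the columns of the witness are the Jordan
  chain N^2 e3, N e3, e3, where N^2 e3 = x y e1.\<close>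

lemma similar_T11_a:
  assumes "x * y \<noteq> 0"
  shows "similar (mat3 [[a, x, z], [0, a, y], [0, 0, a]]) (T11_a a)"
  by (rule similarI[of "mat3 [[x * y, z, 0], [0, y, 0], [0, 0, 1]]"])
    (use assms in \<open>simp_all add: T11_a_def det_mat3 mat3_mult mat3_eq_iff algebra_simps\<close>)

text \<open>The strictly upper triangular part N satisfies N^2 = 0 and N \<noteq> 0. The columns of
  each witness are N v, v and a further kernel vector, with v = e2 if x is nonzero and v = e3
  otherwise.\<close>

lemma similar_T1_a:
  assumes "x * y = 0" "\<not> (x = 0 \<and> y = 0 \<and> z = 0)"
  shows "similar (mat3 [[a, x, z], [0, a, y], [0, 0, a]]) (T1_a a)"
proof -
  consider "x \<noteq> 0" "y = 0" | "x = 0" "y \<noteq> 0" | "x = 0" "y = 0" "z \<noteq> 0" using assms by auto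
  then show ?thesis
  proof cases
    case 1
    then show ?thesis
      by (intro similarI[of "mat3 [[x, 0, 0], [0, 1, - z / x], [0, 0, 1]]"])
        (simp_all add: T1_a_def det_mat3 mat3_mult mat3_eq_iff algebra_simps)
  next
    case 2
    then show ?thesis
      by (intro similarI[of "mat3 [[z, 0, 1], [y, 0, 0], [0, 1, 0]]"])
        (simp_all add: T1_a_def det_mat3 mat3_mult mat3_eq_iff algebra_simps)
  next
    case 3
    then show ?thesis
      by (intro similarI[of "mat3 [[z, 0, 0], [0, 0, 1], [0, 1, 0]]"])
        (simp_all add: T1_a_def det_mat3 mat3_mult mat3_eq_iff algebra_simps)
  qed
qed

text \<open>If exactly two diagonal entries coincide, swaps of adjacent distinct entries bring the
  equal ones to the first two places.\<close>

lemma similar_upper_triangular: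
  "(\<exists>x' y' z'. a = b \<and> b = c \<and> similar (mat3 [[a, x, z], [0, b, y], [0, 0, c]])
       (mat3 [[a, x', z'], [0, a, y'], [0, 0, a]])) \<or>
   (\<exists>d\<in>{a, b, c}. \<exists>e\<in>{a, b, c}. d \<noteq> e \<and>
       (similar (mat3 [[a, x, z], [0, b, y], [0, 0, c]]) (T_ab d e) \<or>
        similar (mat3 [[a, x, z], [0, b, y], [0, 0, c]]) (T1_ab d e))) \<or>
   distinct [a, b, c] \<and> similar (mat3 [[a, x, z], [0, b, y], [0, 0, c]]) (T_abc a b c)"
proof -
  let ?A = "mat3 [[a, x, z], [0, b, y], [0, 0, c]]"
  have aab: "\<exists>d\<in>{a, b, c}. \<exists>e\<in>{a, b, c}. d \<noteq> e \<and> (similar ?A (T_ab d e) \<or> similar ?A (T1_ab d e))"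
    if "similar ?A (mat3 [[d, x', z'], [0, d, y'], [0, 0, e]])" "d \<in> {a, b, c}" "e \<in> {a, b, c}" "d \<noteq> e"
    for d e x' y' z'
    using similar_upper_triangular_aab[OF that(4)] similar_trans[OF that(1)] that(2-4) by meson
  consider "a = b" "b = c" | "a = b" "b \<noteq> c" | "a \<noteq> b" "b = c" | "a \<noteq> b" "a = c"
    | "distinct [a, b, c]" by auto
  then show ?thesis
  proof cases
    case 1
    then show ?thesis using similar_refl by blast
  next
    case 2
    then show ?thesis using aab[of a x z y c] similar_refl by auto
  next
    case 3
    obtain x' y' z' where 1: "similar ?A (mat3 [[b, x', z'], [0, a, y'], [0, 0, b]])"
      using similar_swap_first[OF 3(1)] 3(2) by blast
    obtain x'' y'' z'' where "similar ?A (mat3 [[b, x'', z''], [0, b, y''], [0, 0, a]])"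
      using similar_swap_last[OF 3(1)] similar_trans[OF 1] by blast
    then show ?thesis using aab[of b x'' z'' y'' a] 3 by auto
  next
    case 4
    then have ba: "b \<noteq> a" by simp
    obtain x' y' z' where "similar ?A (mat3 [[a, x', z'], [0, a, y'], [0, 0, b]])"
      using similar_swap_last[OF ba] 4(2) by blast
    then show ?thesis using aab[of a x' z' y' b] 4 by auto
  next
    case 5
    then show ?thesis using similar_upper_triangular_abc[of a b c x z y] by simp
  qed
qed

section \<open>Splitting off an eigenvalue\<close>

lemma mat_mult_vector: "mat a *v v = a *s v"
  by (simp add: matrix_vector_mult_def mat_def vec_eq_iff if_distrib if_distribR cong: if_cong)

lemma mult_axis_nth: "(A *v axis j 1) $ i = A $ i $ j"
  by (simp add: matrix_vector_mult_def axis_def if_distrib cong: if_cong)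

lemma similar_of_eigenvector:
  fixes A :: "'a::field ^ 3 ^ 3"
  assumes "det (A - mat a) = 0"
  obtains x y p r s t where "similar A (mat3 [[a, x, y], [0, p, r], [0, s, t]])"
proof -
  obtain v where v: "v \<noteq> 0" "(A - mat a) *v v = 0" using det_eq_0_imp_kernel[OF assms] .
  have Av: "A *v v = a *s v"
    using v(2) by (simp add: matrix_vector_mult_diff_rdistrib mat_mult_vector)
  \<comment> \<open>The eigenvector replaces a standard basis vector at which its coordinate is
    nonzero, and is placed first.\<close>
  have "\<exists>P. det P \<noteq> 0 \<and> column 1 P = v"
  proof -
    consider "v $ 1 \<noteq> 0" | "v $ 2 \<noteq> 0" | "v $ 3 \<noteq> 0"
      using v(1) by (auto simp: vec_eq_iff forall_3)
    then show ?thesis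
    proof cases
      case 1
      then show ?thesis by (intro exI[of _ "mat3 [[v $ 1, 0, 0], [v $ 2, 1, 0], [v $ 3, 0, 1]]"])
          (simp add: det_mat3 column_def vec_eq_iff forall_3)
    next
      case 2
      then show ?thesis by (intro exI[of _ "mat3 [[v $ 1, 1, 0], [v $ 2, 0, 0], [v $ 3, 0, 1]]"])
          (simp add: det_mat3 column_def vec_eq_iff forall_3)
    next
      case 3
      then show ?thesis by (intro exI[of _ "mat3 [[v $ 1, 1, 0], [v $ 2, 0, 1], [v $ 3, 0, 0]]"])
          (simp add: det_mat3 column_def vec_eq_iff forall_3)
    qed
  qed
  then obtain P where "det P \<noteq> 0" and P: "column 1 P = v" by blast
  then have invP: "invertible P" by (simp add: invertible_det_nz)
  then obtain Q where Q: "P ** Q = mat 1" "Q ** P = mat 1" by (auto simp: invertible_def)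
  define B where "B = Q ** A ** P"
  have "A ** P = P ** B" unfolding B_def by (simp add: matrix_mul_assoc Q)
  then have sim: "similar A B" using invP by (auto simp: similar_def)
  have col: "column 1 M = M *v axis 1 1" for M :: "'a ^ 3 ^ 3"
    by (simp add: column_def vec_eq_iff mult_axis_nth)
  have Qv: "Q *v v = axis 1 1"
    using P Q(2) unfolding col by (metis matrix_vector_mul_assoc matrix_vector_mul_lid)
  have "column 1 B = Q *v (A *v v)"
    using P unfolding col B_def by (simp flip: matrix_vector_mul_assoc)
  also have "\<dots> = a *s axis 1 1" by (simp add: Av Qv vector_scalar_commute)
  finally have "B $ 1 $ 1 = a" "B $ 2 $ 1 = 0" "B $ 3 $ 1 = 0"
    by (simp_all add: column_def vec_eq_iff forall_3 axis_def)
  then have "B = mat3 [[a, B $ 1 $ 2, B $ 1 $ 3], [0, B $ 2 $ 2, B $ 2 $ 3], [0, B $ 3 $ 2, B $ 3 $ 3]]"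
    using mat3_eta[of B] by simp
  with sim that show ?thesis by metis
qed

text \<open>The hypothesis says that a is not an eigenvalue of the block M, so (u w)(M - a) = (x y)
  has a solution, given by Cramer's rule with determinant \<open>d\<close>. It removes the coupling,
  and the witness also moves e1 to the last place.\<close>

lemma similar_block_diagonal:
  assumes "(p - a) * (t - a) \<noteq> r * s"
  shows "similar (mat3 [[a, x, y], [0, p, r], [0, s, t]]) (mat3 [[p, r, 0], [s, t, 0], [0, 0, a]])"
proof -
  define d where "d = (p - a) * (t - a) - r * s"
  define u where "u = (x * (t - a) - s * y) / d"
  define w where "w = ((p - a) * y - r * x) / d"
  have d: "d \<noteq> 0" using assms by (simp add: d_def)
  have "d * ((p - a) * u + s * w) = (p - a) * (d * u) + s * (d * w)" by (simp add: algebra_simps)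
  also have "\<dots> = d * x" using d by (simp add: u_def w_def) (simp add: d_def algebra_simps)
  finally have 1: "(p - a) * u + s * w = x" using d by simp
  have "d * (r * u + (t - a) * w) = r * (d * u) + (t - a) * (d * w)" by (simp add: algebra_simps)
  also have "\<dots> = d * y" using d by (simp add: u_def w_def) (simp add: d_def algebra_simps)
  finally have 2: "r * u + (t - a) * w = y" using d by simp
  have eq1: "a * u + x = u * p + w * s" and eq2: "a * w + y = u * r + w * t"
    by (simp_all only: 1[symmetric] 2[symmetric]) (simp_all add: algebra_simps)
  show ?thesis
    by (rule similarI[of "mat3 [[u, w, 1], [1, 0, 0], [0, 1, 0]]"])
      (simp_all add: det_mat3 mat3_mult mat3_eq_iff eq1 eq2)
qed

lemma similar_upper_triangular_of_eigenvalue: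
  assumes l: "(p - l) * (t - l) = r * s"
  obtains b c x' y' z' where
    "similar (mat3 [[a, x, y], [0, p, r], [0, s, t]]) (mat3 [[a, x', z'], [0, b, y'], [0, 0, c]])"
proof (cases "s = 0")
  case True
  then show ?thesis using that similar_refl by blast
next
  case False
  have l': "p * (l - t) + r * s = l * (l - t)"
    unfolding l[symmetric] by (simp add: algebra_simps)
  \<comment> \<open>The second column (0, l - t, s) is, modulo e1, an eigenvector for l; the
    remaining eigenvalue p + t - l comes from the trace.\<close>
  have "similar (mat3 [[a, x, y], [0, p, r], [0, s, t]])
      (mat3 [[a, x * (l - t) + y * s, x], [0, l, 1], [0, 0, p + t - l]])"
    by (rule similarI[of "mat3 [[1, 0, 0], [0, l - t, 1], [0, s, 0]]"])
      (use False l' in \<open>simp_all add: det_mat3 mat3_mult mat3_eq_iff algebra_simps\<close>)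
  then show ?thesis using that by blast
qed

section \<open>Companion matrices and multiplication in the extensions\<close>

lemma from_coords_scale:
  assumes "field_embedding \<iota>"
  shows "from_coords \<iota> B (c *s v) = \<iota> c * from_coords \<iota> B v"
  by (simp add: from_coords_def field_embedding_simps[OF assms] sum_distrib_left mult.assoc)

lemma from_coords_add:
  assumes "field_embedding \<iota>"
  shows "from_coords \<iota> B (v + w) = from_coords \<iota> B v + from_coords \<iota> B w"
  by (simp add: from_coords_def field_embedding_simps[OF assms] distrib_right sum.distrib)

text \<open>Both matrices are reduced to the companion matrix of the characteristic polynomial
  of the block.\<close>

lemma similar_T_ka:
  fixes \<iota> :: "'a::{field,finite} \<Rightarrow> 'b::{field,finite}"
  assumes \<iota>: "field_embedding \<iota>" and gen: "generator_over \<iota> \<tau>" and K: "CARD('b) = CARD('a) ^ 2"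
    and no: "\<And>l. (p - l) * (t - l) \<noteq> r * s"
  obtains \<kappa> where "\<kappa> \<notin> range \<iota>"
    "similar (mat3 [[p, r, 0], [s, t, 0], [0, 0, a]]) (T_ka \<iota> \<tau> \<kappa> a)"
proof -
  let ?C = "mat3 [[0, r * s - p * t, 0], [1, p + t, 0], [0, 0, a]]"
  let ?B = "vector [1, \<tau>] :: 'b ^ 2"
  have s: "s \<noteq> 0" using no[of t] by auto
  have C1: "similar (mat3 [[p, r, 0], [s, t, 0], [0, 0, a]]) ?C"
    by (rule similarI[of "mat3 [[1, p, 0], [0, s, 0], [0, 0, 1]]"])
      (use s in \<open>simp_all add: det_mat3 mat3_mult mat3_eq_iff algebra_simps\<close>)
  have no': "x\<^sup>2 \<noteq> (r * s - p * t) + (p + t) * x" for x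
  proof
    assume "x\<^sup>2 = (r * s - p * t) + (p + t) * x"
    then have "(p - x) * (t - x) = r * s" by (simp add: power2_eq_square algebra_simps)
    with no show False by blast
  qed
  obtain \<kappa> where \<kappa>: "\<kappa>\<^sup>2 = \<iota> (r * s - p * t) + \<iota> (p + t) * \<kappa>"
    using quadratic_root_in_extension[OF \<iota> K no'] .
  have \<kappa>n: "\<kappa> \<notin> range \<iota>"
  proof
    assume "\<kappa> \<in> range \<iota>"
    then obtain x where "\<kappa> = \<iota> x" by auto
    with \<kappa> have "\<iota> (x\<^sup>2) = \<iota> ((r * s - p * t) + (p + t) * x)"
      by (simp add: field_embedding_simps[OF \<iota>] power2_eq_square)
    with no' show False by (simp only: field_embedding_eq_iff[OF \<iota>])
  qed
  have bij: "bij (from_coords \<iota> ?B)" using quadratic_basis[OF \<iota> gen K] .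
  define M where "M = mult_matrix \<iota> ?B \<kappa>"
  define e :: "'a ^ 2" where "e = vector [1, 0]"
  have e: "from_coords \<iota> ?B e = 1"
    by (simp add: from_coords_def e_def sum_2 field_embedding_simps[OF \<iota>])
  have M: "from_coords \<iota> ?B (M *v v) = \<kappa> * from_coords \<iota> ?B v" for v
    unfolding M_def by (rule from_coords_mult_matrix[OF \<iota> bij])
  have Me: "M *v e = vector [M $ 1 $ 1, M $ 2 $ 1]"
    by (simp add: e_def vec_eq_iff forall_2 matrix_vector_mult_def sum_2)
  \<comment> \<open>Since \<open>e\<close> represents 1, this is the quadratic equation of \<kappa>
    read in coordinates.\<close>
  have "from_coords \<iota> ?B (M *v (M *v e)) = from_coords \<iota> ?B ((r * s - p * t) *s e + (p + t) *s (M *v e))"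
    using \<kappa> by (simp add: M e from_coords_add[OF \<iota>] from_coords_scale[OF \<iota>] power2_eq_square)
  then have "M *v (M *v e) = (r * s - p * t) *s e + (p + t) *s (M *v e)"
    using bij by (meson bij_is_inj injD)
  then have comp: "(M *v (M *v e)) $ i = (r * s - p * t) * e $ i + (p + t) * (M *v e) $ i" for i
    by simp
  have MM: "M $ 1 $ 1 * M $ 1 $ 1 + M $ 1 $ 2 * M $ 2 $ 1 = r * s - p * t + M $ 1 $ 1 * (p + t)"
    using comp[of 1] unfolding Me
    by (simp only: matrix_vector_mult_def vec_lambda_beta sum_2 vector_2 e_def) (simp add: mult.commute)
  have MM': "M $ 2 $ 1 * M $ 1 $ 1 + M $ 2 $ 2 * M $ 2 $ 1 = M $ 2 $ 1 * (p + t)"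
    using comp[of 2] unfolding Me
    by (simp only: matrix_vector_mult_def vec_lambda_beta sum_2 vector_2 e_def) (simp add: mult.commute)
  have M21: "M $ 2 $ 1 \<noteq> 0"
  proof
    assume "M $ 2 $ 1 = 0"
    then have "from_coords \<iota> ?B (M *v e) = \<iota> (M $ 1 $ 1)"
      unfolding Me by (simp add: from_coords_def sum_2 field_embedding_simps[OF \<iota>])
    with \<kappa>n show False by (simp add: M e)
  qed
  have "similar (T_ka \<iota> \<tau> \<kappa> a) ?C"
    unfolding T_ka_def Let_def M_def[symmetric]
    by (rule similarI[of "mat3 [[1, M $ 1 $ 1, 0], [0, M $ 2 $ 1, 0], [0, 0, 1]]"])
      (simp_all add: det_mat3 mat3_mult mat3_eq_iff M21 MM MM')
  then show ?thesis using that[OF \<kappa>n] similar_trans[OF C1 similar_sym] by blast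
qed

text \<open>The determinant is the obstruction to \<open>e\<^sub>1\<close> being a cyclic vector: when it vanishes, the
  span of \<open>e\<^sub>1\<close> and \<open>A e\<^sub>1\<close> is invariant, and \<open>A\<close> has an eigenvalue on the quotient.\<close>

lemma cyclic_vector_of_no_eigenvalue:
  fixes A :: "'a::field ^ 3 ^ 3"
  assumes no: "\<And>c. det (A - mat c) \<noteq> 0"
  defines "u \<equiv> A *v axis 1 1"
  shows "u $ 2 * (A *v u) $ 3 \<noteq> u $ 3 * (A *v u) $ 2"
proof
  obtain a b c s m11 m12 t m21 m22 where A: "A = mat3 [[a, b, c], [s, m11, m12], [t, m21, m22]]"
    by (rule mat3_cases)
  have u: "u $ 1 = a" "u $ 2 = s" "u $ 3 = t"
    by (simp_all add: u_def mult_axis_nth A)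
  have Au: "(A *v u) $ 2 = s * a + m11 * s + m12 * t" "(A *v u) $ 3 = t * a + m21 * s + m22 * t"
    by (simp_all add: matrix_vector_mult_def sum_3 u A)
  assume "u $ 2 * (A *v u) $ 3 = u $ 3 * (A *v u) $ 2"
  then have eq: "s * (m21 * s + m22 * t) = t * (m11 * s + m12 * t)"
    unfolding u Au by (simp add: algebra_simps)
  have det: "det (A - mat x) = (a - x) * ((m11 - x) * (m22 - x) - m12 * m21)
    - b * (s * (m22 - x) - m12 * t) + c * (s * m21 - (m11 - x) * t)" for x
    unfolding A mat_eq_mat3 mat3_diff det_mat3 by (simp add: algebra_simps)
  consider "s = 0" "t = 0" | "s \<noteq> 0" | "s = 0" "t \<noteq> 0" by blast
  then show False
  proof cases
    case 1
    then have "det (A - mat a) = 0" unfolding det by simp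
    with no show False by blast
  next
    case 2
    \<comment> \<open>The functional (0, -t, s) kills e1 and A e1; \<open>x\<close> is the factor by
      which A scales it, that is, the eigenvalue on the quotient.\<close>
    define x where "x = m22 - m12 * t / s"
    have x: "s * (m22 - x) = m12 * t" using 2 by (simp add: x_def)
    have "s * (s * m21 - (m11 - x) * t) = 0" using x eq by algebra
    then have y: "s * m21 = (m11 - x) * t" using 2 by simp
    have "s * ((m11 - x) * (m22 - x) - m12 * m21) = 0" using x y by algebra
    then have "(m11 - x) * (m22 - x) = m12 * m21" using 2 by simp
    then have "det (A - mat x) = 0" unfolding det using x y by simp
    with no show False by blast
  next
    case 3
    then have "m12 = 0" using eq by simp
    then have "det (A - mat m11) = 0" unfolding det using 3 by simp
    with no show False by blast
  qed
qed

text \<open>The witness has columns e1, A e1, A^2 e1. No search for a cyclic vector takes place: in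
  dimension 3 without eigenvalues every nonzero vector is cyclic, so any A shares the choice
  e1.\<close>

lemma similar_companion:
  fixes A :: "'a::field ^ 3 ^ 3"
  assumes no: "\<And>c. det (A - mat c) \<noteq> 0"
  defines "u \<equiv> A *v axis 1 1"
  assumes "A *v (A *v u) = c0 *s axis 1 1 + c1 *s u + c2 *s (A *v u)"
  shows "similar A (mat3 [[0, 0, c0], [1, 0, c1], [0, 1, c2]])"
proof (rule similarI)
  let ?w = "A *v u"
  let ?P = "mat3 [[1, u $ 1, ?w $ 1], [0, u $ 2, ?w $ 2], [0, u $ 3, ?w $ 3]]"
  show "det ?P \<noteq> 0"
    using cyclic_vector_of_no_eigenvalue[OF no] by (simp add: det_mat3 u_def algebra_simps)
  have u: "A $ i $ 1 = u $ i" for i by (simp add: u_def mult_axis_nth)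
  have w: "A $ i $ 1 * u $ 1 + A $ i $ 2 * u $ 2 + A $ i $ 3 * u $ 3 = ?w $ i" for i
    by (simp add: matrix_vector_mult_def sum_3)
  have "(A *v ?w) $ i = A $ i $ 1 * ?w $ 1 + A $ i $ 2 * ?w $ 2 + A $ i $ 3 * ?w $ 3" for i
    by (simp add: matrix_vector_mult_def sum_3)
  then have ww: "A $ i $ 1 * ?w $ 1 + A $ i $ 2 * ?w $ 2 + A $ i $ 3 * ?w $ 3 =
      c0 * axis 1 1 $ i + c1 * u $ i + c2 * ?w $ i" for i
    unfolding assms(3) by simp
  show "A ** ?P = ?P ** mat3 [[0, 0, c0], [1, 0, c1], [0, 1, c2]]"
    using w ww by (simp add: vec_eq_iff forall_3 matrix_matrix_mult_def sum_3 u axis_def mult.commute)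
qed

lemma ex_similar_companion:
  fixes A :: "'a::field ^ 3 ^ 3"
  assumes no: "\<And>c. det (A - mat c) \<noteq> 0"
  obtains c0 c1 c2 where "similar A (mat3 [[0, 0, c0], [1, 0, c1], [0, 1, c2]])"
proof -
  define u where "u = A *v axis 1 1"
  define w where "w = A *v u"
  define x where "x = A *v w"
  \<comment> \<open>Cramer's rule in coordinates 2 and 3 gives \<open>c1\<close> and
    \<open>c2\<close>; the coefficient of e1 then absorbs coordinate 1.\<close>
  define d where "d = u $ 2 * w $ 3 - u $ 3 * w $ 2"
  define c1 where "c1 = (x $ 2 * w $ 3 - x $ 3 * w $ 2) / d"
  define c2 where "c2 = (u $ 2 * x $ 3 - u $ 3 * x $ 2) / d"
  have d: "d \<noteq> 0"
    using cyclic_vector_of_no_eigenvalue[OF no] by (simp add: d_def w_def u_def)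
  have c: "d * c1 = x $ 2 * w $ 3 - x $ 3 * w $ 2" "d * c2 = u $ 2 * x $ 3 - u $ 3 * x $ 2"
    using d by (simp_all add: c1_def c2_def)
  have "d * (c1 * u $ i + c2 * w $ i) = d * x $ i" if "i = 2 \<or> i = 3" for i
  proof -
    have "d * (c1 * u $ i + c2 * w $ i) = d * c1 * u $ i + d * c2 * w $ i"
      by (simp add: algebra_simps)
    also have "\<dots> = d * x $ i"
      unfolding c using that by (auto simp: d_def algebra_simps)
    finally show ?thesis .
  qed
  then have "c1 * u $ i + c2 * w $ i = x $ i" if "i = 2 \<or> i = 3" for i
    using d that by (metis mult_cancel_left)
  then have "x = (x $ 1 - c1 * u $ 1 - c2 * w $ 1) *s axis 1 1 + c1 *s u + c2 *s w"
    by (simp add: vec_eq_iff forall_3 axis_def)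
  then show ?thesis
    using similar_companion[OF no] that unfolding x_def w_def u_def by blast
qed

text \<open>\<open>A\<close> and multiplication by a root z of its characteristic polynomial have
  the same companion matrix. Multiplication by z has no eigenvalue, as z v = c v with v \<noteq> 0
  would put z in the base field, and e1 represents 1, so its cyclic relation is the cubic equation
  of z.\<close>

lemma similar_T_z:
  fixes \<iota> :: "'a::{field,finite} \<Rightarrow> 'b::{field,finite}"
  assumes \<iota>: "field_embedding \<iota>" and gen: "generator_over \<iota> \<sigma>" and K: "CARD('b) = CARD('a) ^ 3"
    and no: "\<And>c. det (A - mat c) \<noteq> 0"
  obtains z where "z \<notin> range \<iota>" "similar A (T_z \<iota> \<sigma> z)"
proof -
  obtain c0 c1 c2 where A: "similar A (mat3 [[0, 0, c0], [1, 0, c1], [0, 1, c2]])"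
    using ex_similar_companion[OF no] .
  have "det (A - mat x) = c0 + c1 * x + c2 * x\<^sup>2 - x ^ 3" for x
    by (subst det_diff_mat_similar[OF A], simp only: mat_eq_mat3 mat3_diff det_mat3)
      (simp add: algebra_simps power2_eq_square power3_eq_cube)
  with no have no': "x ^ 3 \<noteq> c0 + c1 * x + c2 * x\<^sup>2" for x by (metis diff_self)
  obtain z where z: "z ^ 3 = \<iota> c0 + \<iota> c1 * z + \<iota> c2 * z\<^sup>2"
    using cubic_root_in_extension[OF \<iota> K no'] .
  have zn: "z \<notin> range \<iota>"
  proof
    assume "z \<in> range \<iota>"
    then obtain x where "z = \<iota> x" by auto
    with z have "\<iota> (x ^ 3) = \<iota> (c0 + c1 * x + c2 * x\<^sup>2)"
      by (simp add: field_embedding_simps[OF \<iota>] power2_eq_square power3_eq_cube)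
    with no' show False by (simp only: field_embedding_eq_iff[OF \<iota>])
  qed
  define B where "B = (vector [1, \<sigma>, \<sigma>\<^sup>2] :: 'b ^ 3)"
  have bij: "bij (from_coords \<iota> B)" unfolding B_def using cubic_basis[OF \<iota> gen K] .
  have inj: "v = w" if "from_coords \<iota> B v = from_coords \<iota> B w" for v w
    using bij that by (meson bij_is_inj injD)
  let ?T = "T_z \<iota> \<sigma> z"
  have T: "from_coords \<iota> B (?T *v v) = z * from_coords \<iota> B v" for v
    unfolding T_z_def B_def[symmetric] by (rule from_coords_mult_matrix[OF \<iota> bij])
  have noT: "det (?T - mat c) \<noteq> 0" for c
  proof
    assume "det (?T - mat c) = 0"
    then obtain v where v: "v \<noteq> 0" "(?T - mat c) *v v = 0" by (rule det_eq_0_imp_kernel)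
    then have "?T *v v = c *s v"
      by (simp add: matrix_vector_mult_diff_rdistrib mat_mult_vector)
    then have "z * from_coords \<iota> B v = \<iota> c * from_coords \<iota> B v"
      using T[of v] by (metis from_coords_scale[OF \<iota>])
    moreover have "from_coords \<iota> B v \<noteq> 0"
    proof
      assume "from_coords \<iota> B v = 0"
      then have "from_coords \<iota> B v = from_coords \<iota> B 0"
        by (simp add: from_coords_def field_embedding_simps[OF \<iota>])
      then have "v = 0" by (rule inj)
      with v(1) show False by simp
    qed
    ultimately have "z = \<iota> c" by simp
    with zn show False by blast
  qed
  let ?e = "axis 1 1 :: 'a ^ 3"
  have e: "from_coords \<iota> B ?e = 1"
    by (simp add: from_coords_def B_def axis_def sum_3 field_embedding_simps[OF \<iota>])
  have "?T *v (?T *v (?T *v ?e)) = c0 *s ?e + c1 *s (?T *v ?e) + c2 *s (?T *v (?T *v ?e))"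
    using z by (intro inj) (simp add: T e from_coords_add[OF \<iota>] from_coords_scale[OF \<iota>]
        power2_eq_square power3_eq_cube mult.assoc)
  then have "similar ?T (mat3 [[0, 0, c0], [1, 0, c1], [0, 1, c2]])"
    by (rule similar_companion[OF noT])
  then show ?thesis using that[OF zn] similar_trans[OF A similar_sym] by blast
qed

section \<open>Nilpotency up to a scalar and the classification\<close>

lemma similar_cube:
  assumes "similar A B"
  shows "similar (A ** A ** A) (B ** B ** B)"
proof -
  obtain P where P: "invertible P" "A ** P = P ** B" using assms by (auto simp: similar_def)
  have *: "M ** A ** P = M ** P ** B" for M
    using P(2) by (metis matrix_mul_assoc)
  have "A ** A ** A ** P = A ** A ** P ** B" by (rule *)
  also have "\<dots> = P ** B ** B ** B" unfolding * P(2) by (rule refl)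
  also have "\<dots> = P ** (B ** B ** B)" by (simp only: matrix_mul_assoc)
  finally show ?thesis using P(1) by (auto simp: similar_def)
qed

lemma similar_0_iff:
  fixes A :: "'a::field ^ 'n ^ 'n"
  shows "similar A 0 \<longleftrightarrow> A = 0"
proof
  assume "similar A 0"
  then obtain P :: "'a ^ 'n ^ 'n" where P: "invertible P" "A ** P = P ** 0"
    by (auto simp: similar_def)
  then obtain Q where "P ** Q = mat 1" by (auto simp: invertible_def)
  then have "A = (A ** P) ** Q" by (simp flip: matrix_mul_assoc)
  then show "A = 0" unfolding P by simp
qed (simp add: similar_refl)

lemma zero_eq_mat3: "0 = mat3 [[0, 0, 0], [0, 0, 0], [0, 0, 0]]"
  by (simp add: vec_eq_iff forall_3)

lemma cube_upper_triangular_diff_mat: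
  fixes a x y z :: "'a::field"
  defines "N \<equiv> mat3 [[a, x, z], [0, a, y], [0, 0, a]] - mat a"
  shows "N ** N ** N = 0"
  by (simp add: N_def mat_eq_mat3 mat3_diff mat3_mult zero_eq_mat3)

lemma cube_block_diff_mat_neq_0:
  fixes p r s t a :: "'a::field"
  assumes no: "\<And>l. (p - l) * (t - l) \<noteq> r * s"
  defines "N \<equiv> \<lambda>c. mat3 [[p, r, 0], [s, t, 0], [0, 0, a]] - mat c"
  shows "N c ** N c ** N c \<noteq> 0"
proof
  \<comment> \<open>Putting 1 in the corner instead of a - c makes the determinant exactly that of
    the block, so its vanishing contradicts \<open>no\<close> even if a = c.\<close>
  let ?M = "mat3 [[p - c, r, 0], [s, t - c, 0], [0, 0, 1]]"
  assume 0: "N c ** N c ** N c = 0"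
  have "?M ** ?M ** ?M = mat3 [[0, 0, 0], [0, 0, 0], [0, 0, 1]]"
    using 0 by (simp add: N_def mat_eq_mat3 mat3_diff mat3_mult zero_eq_mat3 mat3_eq_iff)
  then have "det (?M ** ?M ** ?M) = 0" by (simp only: det_mat3) simp
  then have "det ?M = 0" by (simp add: det_mul)
  then show False using no[of c] by (simp add: det_mat3)
qed

text \<open>The exponent 3 is chosen for size 3, where the cube of a nilpotent matrix is always
  zero.\<close>

definition unipotent_up_to_scalar :: "'a::field ^ 'n ^ 'n \<Rightarrow> 'a \<Rightarrow> bool" where
  "unipotent_up_to_scalar A c \<longleftrightarrow> (A - mat c) ** (A - mat c) ** (A - mat c) = 0"

lemma similar_unipotent_up_to_scalar:
  assumes "similar A B"
  shows "unipotent_up_to_scalar A c \<longleftrightarrow> unipotent_up_to_scalar B c"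
  using similar_cube[OF similar_diff_mat[OF assms, of c]] similar_sym similar_0_iff
  unfolding unipotent_up_to_scalar_def by metis

text \<open>The unipotent case stays triangular because the division into three classes is made
  later by the entries. The other cases carry the failure of unipotency, which is what kills the
  induced characters.\<close>

lemma GL3_classification:
  fixes \<iota>\<^sub>2 :: "'k::{field,finite} \<Rightarrow> 'e::{field,finite}" and \<iota>\<^sub>3 :: "'k \<Rightarrow> 'l::{field,finite}"
  assumes K: "CARD('e) = CARD('k) ^ 2" "CARD('l) = CARD('k) ^ 3"
    and \<iota>: "field_embedding \<iota>\<^sub>2" "field_embedding \<iota>\<^sub>3"
    and gen: "generator_over \<iota>\<^sub>2 \<tau>" "generator_over \<iota>\<^sub>3 \<sigma>"
    and det: "det A \<noteq> 0"
  obtains (unipotent) a x y z where "a \<noteq> 0" "similar A (mat3 [[a, x, z], [0, a, y], [0, 0, a]])"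
  | (T_ab) a b where "a \<noteq> 0" "b \<noteq> 0" "a \<noteq> b" "similar A (T_ab a b)"
      "\<And>c. \<not> unipotent_up_to_scalar A c"
  | (T1_ab) a b where "a \<noteq> 0" "b \<noteq> 0" "a \<noteq> b" "similar A (T1_ab a b)"
      "\<And>c. \<not> unipotent_up_to_scalar A c"
  | (T_abc) a b c where "a \<noteq> 0" "b \<noteq> 0" "c \<noteq> 0" "distinct [a, b, c]"
      "similar A (T_abc a b c)" "\<And>c. \<not> unipotent_up_to_scalar A c"
  | (T_ka) \<kappa> a where "\<kappa> \<notin> range \<iota>\<^sub>2" "a \<noteq> 0"
      "similar A (T_ka \<iota>\<^sub>2 \<tau> \<kappa> a)" "\<And>c. \<not> unipotent_up_to_scalar A c"
  | (T_z) z where "z \<notin> range \<iota>\<^sub>3" "similar A (T_z \<iota>\<^sub>3 \<sigma> z)"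
      "\<And>c. \<not> unipotent_up_to_scalar A c"
proof (cases "\<forall>c. det (A - mat c) \<noteq> 0")
  case True
  have "\<not> unipotent_up_to_scalar A c" for c
  proof
    assume "unipotent_up_to_scalar A c"
    moreover have "det (0 :: 'k ^ 3 ^ 3) = 0" by (simp only: zero_eq_mat3 det_mat3) simp
    ultimately have "det ((A - mat c) ** (A - mat c) ** (A - mat c)) = 0"
      by (simp only: unipotent_up_to_scalar_def)
    then show False using True by (simp add: det_mul)
  qed
  note nu = this
  obtain z where "z \<notin> range \<iota>\<^sub>3" "similar A (T_z \<iota>\<^sub>3 \<sigma> z)"
    by (rule similar_T_z[OF \<iota>(2) gen(2) K(2), of A]) (use True in blast)+
  then show ?thesis using nu by (rule T_z)
next
  case False
  then obtain c where "det (A - mat c) = 0" by blast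
  then obtain a x y p r s t where A: "similar A (mat3 [[a, x, y], [0, p, r], [0, s, t]])"
    by (rule similar_of_eigenvector)
  have dA: "det A = a * (p * t - r * s)"
    unfolding det_similar[OF A] det_mat3 by (simp add: algebra_simps)
  show ?thesis
  proof (cases "\<forall>l. (p - l) * (t - l) \<noteq> r * s")
    case True
    let ?B = "mat3 [[p, r, 0], [s, t, 0], [0, 0, a]]"
    \<comment> \<open>The instance l = a says that a is not an eigenvalue of the block, so it splits
      off.\<close>
    have B: "similar A ?B" using similar_trans[OF A similar_block_diagonal] True by blast
    have "\<not> unipotent_up_to_scalar ?B c" for c
      unfolding unipotent_up_to_scalar_def using True by (intro cube_block_diff_mat_neq_0) auto
    then have "\<not> unipotent_up_to_scalar A c" for c
      using similar_unipotent_up_to_scalar[OF B] by blast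
    note nu = this
    obtain \<kappa> where \<kappa>: "\<kappa> \<notin> range \<iota>\<^sub>2" "similar ?B (T_ka \<iota>\<^sub>2 \<tau> \<kappa> a)"
      by (rule similar_T_ka[OF \<iota>(1) gen(1) K(1), of p t r s]) (use True in blast)+
    have "a \<noteq> 0" using det dA by auto
    then show ?thesis by (rule T_ka[OF \<kappa>(1) _ similar_trans[OF B \<kappa>(2)] nu])
  next
    case False
    then obtain l where "(p - l) * (t - l) = r * s" by blast
    then obtain b c x' y' z' where
      "similar (mat3 [[a, x, y], [0, p, r], [0, s, t]]) (mat3 [[a, x', z'], [0, b, y'], [0, 0, c]])"
      by (rule similar_upper_triangular_of_eigenvalue)
    then have B: "similar A (mat3 [[a, x', z'], [0, b, y'], [0, 0, c]])"
      using similar_trans[OF A] by blast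
    have nz: "a \<noteq> 0" "b \<noteq> 0" "c \<noteq> 0" using det det_similar[OF B] by (auto simp: det_mat3)
    consider (1) x'' y'' z'' where "similar A (mat3 [[a, x'', z''], [0, a, y''], [0, 0, a]])"
      | (2) d e where "d \<noteq> 0" "e \<noteq> 0" "d \<noteq> e" "similar A (T_ab d e) \<or> similar A (T1_ab d e)"
      | (3) "distinct [a, b, c]" "similar A (T_abc a b c)"
      using similar_upper_triangular[of a b c x' z' y'] similar_trans[OF B] nz by blast
    then show ?thesis
    proof cases
      case 1
      then show ?thesis using unipotent nz by blast
    next
      case 2
      have "\<not> unipotent_up_to_scalar (T_ab d e) c" "\<not> unipotent_up_to_scalar (T1_ab d e) c" for c
        using 2(3) by (auto simp: unipotent_up_to_scalar_def T_ab_def T1_ab_def mat_eq_mat3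
            mat3_diff mat3_mult zero_eq_mat3 mat3_eq_iff)
      then have "\<not> unipotent_up_to_scalar A c" for c
        using 2(4) similar_unipotent_up_to_scalar by blast
      note nu = this
      show ?thesis using 2(4) T_ab[OF 2(1-3) _ nu] T1_ab[OF 2(1-3) _ nu] by blast
    next
      case 3
      have "\<not> unipotent_up_to_scalar (T_abc a b c) d" for d
        using 3(1) by (auto simp: unipotent_up_to_scalar_def T_abc_def mat_eq_mat3
            mat3_diff mat3_mult zero_eq_mat3 mat3_eq_iff)
      then have "\<not> unipotent_up_to_scalar A c" for c
        using 3(2) similar_unipotent_up_to_scalar by blast
      note nu = this
      show ?thesis by (rule T_abc[OF nz 3 nu])
    qed
  qed
qed

section \<open>Induced characters of general linear groups\<close>

lemma invertible_mat_one: "invertible (mat 1 :: 'a::field ^ 'n ^ 'n)"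
  by (simp add: invertible_det_nz)

lemma group_GL: "group (GL :: ('a::field ^ 'n ^ 'n) monoid)"
proof (rule groupI)
  fix A assume "A \<in> carrier (GL :: ('a ^ 'n ^ 'n) monoid)"
  then show "\<exists>B\<in>carrier GL. B \<otimes>\<^bsub>GL\<^esub> A = \<one>\<^bsub>GL\<^esub>"
    by (auto simp: GL_def invertible_def)
qed (auto simp: GL_def invertible_mult matrix_mul_assoc invertible_mat_one)

text \<open>Trades the group inverse for an intertwining equation, the form in which
  \<open>similar\<close> and centralizers are stated.\<close>

lemma conjugate_GL_eq_iff:
  fixes x g y :: "'a::field ^ 'n ^ 'n"
  assumes "invertible x"
  shows "m_inv GL x \<otimes>\<^bsub>GL\<^esub> g \<otimes>\<^bsub>GL\<^esub> x = y \<longleftrightarrow> g ** x = x ** y"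
proof -
  interpret group "GL :: ('a ^ 'n ^ 'n) monoid" by (rule group_GL)
  have "x \<in> carrier GL" using assms by (simp add: GL_def)
  then have inv: "m_inv GL x ** x = mat 1" "x ** m_inv GL x = mat 1"
    using l_inv[of x] r_inv[of x] by (simp_all add: GL_def)
  show ?thesis
  proof
    assume "m_inv GL x \<otimes>\<^bsub>GL\<^esub> g \<otimes>\<^bsub>GL\<^esub> x = y"
    then have "x ** y = (x ** m_inv GL x) ** g ** x" by (auto simp: GL_def matrix_mul_assoc)
    then show "g ** x = x ** y" by (simp add: inv)
  next
    assume "g ** x = x ** y"
    then have "m_inv GL x ** (g ** x) = m_inv GL x ** (x ** y)" by simp
    then have "m_inv GL x ** g ** x = (m_inv GL x ** x) ** y" by (simp only: matrix_mul_assoc)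
    then show "m_inv GL x \<otimes>\<^bsub>GL\<^esub> g \<otimes>\<^bsub>GL\<^esub> x = y" using inv by (simp add: GL_def)
  qed
qed

definition centralizer_GL :: "'a::field ^ 'n ^ 'n \<Rightarrow> ('a ^ 'n ^ 'n) set" where
  "centralizer_GL t = {x. invertible x \<and> t ** x = x ** t}"

text \<open>Fix intertwiners R for g, t and P for t, y. Every intertwiner for g, y is then R c P for
  a unique c in the centralizer of t.\<close>

lemma card_intertwiners:
  fixes g t y :: "'a::{field,finite} ^ 'n ^ 'n"
  assumes "similar g t" "similar t y"
  shows "card {x. invertible x \<and> g ** x = x ** y} = card (centralizer_GL t)"
proof -
  obtain R where R: "invertible R" "g ** R = R ** t" using assms by (auto simp: similar_def)
  obtain P where P: "invertible P" "t ** P = P ** y" using assms by (auto simp: similar_def)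
  obtain R' where R': "R ** R' = mat 1" "R' ** R = mat 1" using R by (auto simp: invertible_def)
  obtain P' where P': "P ** P' = mat 1" "P' ** P = mat 1" using P by (auto simp: invertible_def)
  have inv': "invertible R'" "invertible P'" using R' P' by (auto simp: invertible_def)
  have tR: "t ** R' = R' ** g"
  proof -
    have "t ** R' = (R' ** R) ** t ** R'" by (simp add: R')
    also have "\<dots> = R' ** (R ** t) ** R'" by (simp only: matrix_mul_assoc)
    also have "\<dots> = R' ** g ** (R ** R')" unfolding R(2)[symmetric] by (simp only: matrix_mul_assoc)
    finally show ?thesis by (simp add: R')
  qed
  have yP: "y ** P' = P' ** t"
  proof -
    have "y ** P' = (P' ** P) ** y ** P'" by (simp add: P')
    also have "\<dots> = P' ** (P ** y) ** P'" by (simp only: matrix_mul_assoc)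
    also have "\<dots> = P' ** t ** (P ** P')" unfolding P(2)[symmetric] by (simp only: matrix_mul_assoc)
    finally show ?thesis by (simp add: P')
  qed
  have "bij_betw (\<lambda>c. R ** c ** P) (centralizer_GL t) {x. invertible x \<and> g ** x = x ** y}"
  proof (rule bij_betwI[where g = "\<lambda>x. R' ** x ** P'"])
    show "(\<lambda>c. R ** c ** P) \<in> centralizer_GL t \<rightarrow> {x. invertible x \<and> g ** x = x ** y}"
    proof safe
      fix c assume "c \<in> centralizer_GL t"
      then have c: "invertible c" "t ** c = c ** t" by (auto simp: centralizer_GL_def)
      show "invertible (R ** c ** P)" using R(1) P(1) c(1) by (simp add: invertible_mult)
      have "g ** (R ** c ** P) = (g ** R) ** c ** P" by (simp only: matrix_mul_assoc)
      also have "\<dots> = R ** (t ** c) ** P" unfolding R(2) by (simp only: matrix_mul_assoc)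
      also have "\<dots> = R ** c ** (t ** P)" unfolding c(2) by (simp only: matrix_mul_assoc)
      also have "\<dots> = R ** c ** P ** y" unfolding P(2) by (simp only: matrix_mul_assoc)
      finally show "g ** (R ** c ** P) = R ** c ** P ** y" .
    qed
    show "(\<lambda>x. R' ** x ** P') \<in> {x. invertible x \<and> g ** x = x ** y} \<rightarrow> centralizer_GL t"
    proof safe
      fix x assume x: "invertible x" "g ** x = x ** y"
      have "t ** (R' ** x ** P') = (t ** R') ** x ** P'" by (simp only: matrix_mul_assoc)
      also have "\<dots> = R' ** (g ** x) ** P'" unfolding tR by (simp only: matrix_mul_assoc)
      also have "\<dots> = R' ** x ** (y ** P')" unfolding x(2) by (simp only: matrix_mul_assoc)
      also have "\<dots> = R' ** x ** P' ** t" unfolding yP by (simp only: matrix_mul_assoc)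
      finally show "R' ** x ** P' \<in> centralizer_GL t"
        using inv' x(1) by (simp add: centralizer_GL_def invertible_mult)
    qed
    have "R' ** (R ** c ** P) ** P' = (R' ** R) ** c ** (P ** P')" for c
      by (simp only: matrix_mul_assoc)
    then show "R' ** (R ** c ** P) ** P' = c" for c by (simp add: R' P')
    have "R ** (R' ** x ** P') ** P = (R ** R') ** x ** (P' ** P)" for x
      by (simp only: matrix_mul_assoc)
    then show "R ** (R' ** x ** P') ** P = x" for x by (simp add: R' P')
  qed
  then show ?thesis by (rule bij_betw_same_card[symmetric])
qed

text \<open>The sum over x is fibred over the conjugate y of g by x; each fibre is a set of
  intertwiners. Counting at the representative \<open>t\<close> makes the centralizer
  explicit.\<close>

lemma induced_character_GL_eq:
  fixes g t :: "'a::{field,finite} ^ 'n ^ 'n"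
  assumes "similar g t"
  shows "induced_character GL H \<theta> g =
    of_nat (card (centralizer_GL t)) * (\<Sum>y\<in>{y\<in>H. similar t y}. \<theta> y) / of_nat (card H)"
proof -
  let ?G = "carrier (GL :: ('a ^ 'n ^ 'n) monoid)"
  define f where "f x = m_inv GL x \<otimes>\<^bsub>GL\<^esub> g \<otimes>\<^bsub>GL\<^esub> x" for x
  define F where "F y = (if y \<in> H then \<theta> y else 0)" for y
  have f: "f x = y \<longleftrightarrow> g ** x = x ** y" if "x \<in> ?G" for x y
    using that conjugate_GL_eq_iff by (auto simp: f_def GL_def)
  have img: "f ` ?G = {y. similar t y}"
  proof (intro Set.set_eqI iffI)
    fix y assume "y \<in> f ` ?G"
    then obtain x where "x \<in> ?G" "g ** x = x ** y" using f by auto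
    then have "similar g y" by (auto simp: similar_def GL_def)
    then show "y \<in> {y. similar t y}" using assms similar_sym similar_trans by blast
  next
    fix y assume "y \<in> {y. similar t y}"
    then have "similar g y" using assms similar_trans by blast
    then obtain x where "x \<in> ?G" "g ** x = x ** y" by (auto simp: similar_def GL_def)
    then have "f x = y" "x \<in> ?G" using f by simp_all
    then show "y \<in> f ` ?G" by blast
  qed
  have fiber: "card {x \<in> ?G. f x = y} = card (centralizer_GL t)" if "similar t y" for y
  proof -
    have "{x \<in> ?G. f x = y} = {x. invertible x \<and> g ** x = x ** y}"
      using f by (auto simp: GL_def)
    then show ?thesis using card_intertwiners[OF assms that] by simp
  qed
  have "(\<Sum>x\<in>?G. F (f x)) = (\<Sum>y\<in>f ` ?G. \<Sum>x\<in>{x \<in> ?G. f x = y}. F (f x))"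
    by (rule sum.image_gen) simp
  also have "\<dots> = (\<Sum>y\<in>{y. similar t y}. of_nat (card (centralizer_GL t)) * F y)"
    unfolding img by (rule sum.cong) (simp_all add: fiber)
  also have "\<dots> = of_nat (card (centralizer_GL t)) * (\<Sum>y\<in>{y\<in>H. similar t y}. \<theta> y)"
    unfolding F_def sum_distrib_left[symmetric]
    by (intro arg_cong2[where f="(*)"] refl sum.mono_neutral_cong_right) auto
  finally show ?thesis
    by (simp add: induced_character_def f_def F_def Let_def)
qed

text \<open>Cyclicity of the trace. A representation is multiplicative on the invertible matrices,
  so g, t and the conjugating matrix must all be invertible.\<close>

lemma character_similar:
  assumes \<rho>: "irreducible_representation GL \<rho>" and "invertible g" "invertible t" "similar g t"
  shows "character \<rho> g = character \<rho> t"
proof -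
  obtain P where P: "invertible P" "g ** P = P ** t" using assms(4) by (auto simp: similar_def)
  have hom: "\<rho> \<in> hom GL GL" using \<rho> by (simp add: irreducible_representation_def)
  have mult: "\<rho> (x ** y) = \<rho> x ** \<rho> y" if "invertible x" "invertible y" for x y
    using hom_mult[OF hom, of x y] that by (simp add: GL_def)
  have "invertible (\<rho> P)" using hom_in_carrier[OF hom, of P] P by (simp add: GL_def)
  then obtain Q where Q: "\<rho> P ** Q = mat 1" "Q ** \<rho> P = mat 1" by (auto simp: invertible_def)
  have "\<rho> g ** \<rho> P = \<rho> P ** \<rho> t"
    using mult[OF assms(2) P(1)] mult[OF P(1) assms(3)] P(2) by simp
  then have "\<rho> g ** (\<rho> P ** Q) = \<rho> P ** (\<rho> t ** Q)" by (simp add: matrix_mul_assoc)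
  then have "trace (\<rho> g) = trace (\<rho> P ** (\<rho> t ** Q))" by (simp add: Q)
  also have "\<dots> = trace ((\<rho> t ** Q) ** \<rho> P)" by (rule trace_mul_sym)
  also have "\<dots> = trace (\<rho> t)" by (simp add: Q flip: matrix_mul_assoc)
  finally show ?thesis by (simp add: character_def)
qed

section \<open>Orders of centralizers and of GL(3)\<close>

lemma centralizer_GL_scalar: "centralizer_GL (mat a) = {x. invertible x}"
  by (simp add: centralizer_GL_def mat_commute)

text \<open>Commuting with the matrix unit E12 clears the first column and the second row off the
  diagonal and equates their diagonal entries. The determinant is p^2 u, so p and u are nonzero and
  three entries are free.\<close>

lemma card_centralizer_T1_a:
  "card (centralizer_GL (T1_a (a :: 'a::{field,finite}))) = (CARD('a) - 1)\<^sup>2 * CARD('a) ^ 3"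
proof -
  let ?f = "\<lambda>(p, u, r, s, t). mat3 [[p, r, s], [0, p, 0], [0, t, u :: 'a]]"
  let ?S = "(UNIV - {0}) \<times> (UNIV - {0}) \<times> UNIV \<times> UNIV \<times> UNIV :: ('a \<times> 'a \<times> 'a \<times> 'a \<times> 'a) set"
  have "centralizer_GL (T1_a a) = ?f ` ?S"
  proof (intro Set.set_eqI iffI)
    fix x assume x: "x \<in> centralizer_GL (T1_a a)"
    obtain p r s d e f g h i where xe: "x = mat3 [[p, r, s], [d, e, f], [g, h, i]]"
      by (rule mat3_cases)
    have "T1_a a ** x = x ** T1_a a" and det: "det x \<noteq> 0"
      using x by (simp_all add: centralizer_GL_def invertible_det_nz)
    then have e: "d = 0 \<and> f = 0 \<and> g = 0 \<and> e = p"
      by (simp add: xe T1_a_def mat3_mult mat3_eq_iff mult.commute)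
    then have "p \<noteq> 0" "i \<noteq> 0"
      using det by (auto simp: xe det_mat3)
    then have "x = ?f (p, i, r, s, h)" "(p, i, r, s, h) \<in> ?S" using e by (auto simp: xe)
    then show "x \<in> ?f ` ?S" by blast
  next
    fix x assume "x \<in> ?f ` ?S"
    then show "x \<in> centralizer_GL (T1_a a)"
      by (auto simp: centralizer_GL_def T1_a_def mat3_mult mat3_eq_iff invertible_det_nz
          det_mat3 mult.commute)
  qed
  moreover have "inj_on ?f ?S" by (rule inj_onI) (clarsimp simp: mat3_eq_iff)
  ultimately have "card (centralizer_GL (T1_a a)) = card ?S" by (simp only: card_image)
  then show ?thesis by (simp add: card_cartesian_product power2_eq_square power3_eq_cube)
qed

text \<open>The centralizer of a single Jordan block consists of the invertible polynomials p + r N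
  + s N^2 in its nilpotent part.\<close>

lemma card_centralizer_T11_a:
  "card (centralizer_GL (T11_a (a :: 'a::{field,finite}))) = (CARD('a) - 1) * CARD('a) ^ 2"
proof -
  let ?f = "\<lambda>(p, r, s). mat3 [[p, r, s], [0, p, r], [0, 0, p :: 'a]]"
  let ?S = "(UNIV - {0}) \<times> UNIV \<times> UNIV :: ('a \<times> 'a \<times> 'a) set"
  have "centralizer_GL (T11_a a) = ?f ` ?S"
  proof (intro Set.set_eqI iffI)
    fix x assume x: "x \<in> centralizer_GL (T11_a a)"
    obtain p r s d e f g h i where xe: "x = mat3 [[p, r, s], [d, e, f], [g, h, i]]"
      by (rule mat3_cases)
    have "T11_a a ** x = x ** T11_a a" and det: "det x \<noteq> 0"
      using x by (simp_all add: centralizer_GL_def invertible_det_nz)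
    then have e: "d = 0 \<and> f = r \<and> g = 0 \<and> h = 0 \<and> e = p \<and> i = p"
      by (simp add: xe T11_a_def mat3_mult mat3_eq_iff mult.commute)
    then have "p \<noteq> 0"
      using det by (auto simp: xe det_mat3)
    then have "x = ?f (p, r, s)" "(p, r, s) \<in> ?S" using e by (auto simp: xe)
    then show "x \<in> ?f ` ?S" by blast
  next
    fix x assume "x \<in> ?f ` ?S"
    then show "x \<in> centralizer_GL (T11_a a)"
      by (auto simp: centralizer_GL_def T11_a_def mat3_mult mat3_eq_iff invertible_det_nz
          det_mat3 mult.commute)
  qed
  moreover have "inj_on ?f ?S" by (rule inj_onI) (clarsimp simp: mat3_eq_iff)
  ultimately have "card (centralizer_GL (T11_a a)) = card ?S" by (simp only: card_image)
  then show ?thesis by (simp add: card_cartesian_product power2_eq_square)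
qed

text \<open>Solve for a coordinate with nonzero coefficient. This counts the third rows that make a
  matrix singular once the first two are independent.\<close>

lemma card_plane:
  fixes n1 n2 n3 :: "'a::{field,finite}"
  assumes "(n1, n2, n3) \<noteq> 0"
  shows "card {(x, y, z). n1 * x + n2 * y + n3 * z = 0} = CARD('a) ^ 2"
proof -
  let ?S = "{(x, y, z). n1 * x + n2 * y + n3 * z = 0}"
  have solve: "n * x + w = 0 \<longleftrightarrow> x = - w / n" if "n \<noteq> 0" for n x w :: 'a
    using that by (auto simp: field_simps add_eq_0_iff2)
  consider "n1 \<noteq> 0" | "n2 \<noteq> 0" | "n3 \<noteq> 0" using assms by (auto simp: zero_prod_def)
  then have "\<exists>f. bij_betw f (UNIV :: ('a \<times> 'a) set) ?S"
  proof cases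
    case 1
    have "n1 * x + n2 * y + n3 * z = 0 \<longleftrightarrow> x = - (n2 * y + n3 * z) / n1" for x y z
      using solve[OF 1, of x "n2 * y + n3 * z"] by (simp only: ac_simps)
    then have "bij_betw (\<lambda>(y, z). (- (n2 * y + n3 * z) / n1, y, z)) UNIV ?S"
      by (intro bij_betwI[where g = "\<lambda>(x, y, z). (y, z)"]) auto
    then show ?thesis by blast
  next
    case 2
    have "n1 * x + n2 * y + n3 * z = 0 \<longleftrightarrow> y = - (n1 * x + n3 * z) / n2" for x y z
      using solve[OF 2, of y "n1 * x + n3 * z"] by (simp only: ac_simps)
    then have "bij_betw (\<lambda>(x, z). (x, - (n1 * x + n3 * z) / n2, z)) UNIV ?S"
      by (intro bij_betwI[where g = "\<lambda>(x, y, z). (x, z)"]) auto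
    then show ?thesis by blast
  next
    case 3
    have "n1 * x + n2 * y + n3 * z = 0 \<longleftrightarrow> z = - (n1 * x + n2 * y) / n3" for x y z
      using solve[OF 3, of z "n1 * x + n2 * y"] by (simp only: ac_simps)
    then have "bij_betw (\<lambda>(x, y). (x, y, - (n1 * x + n2 * y) / n3)) UNIV ?S"
      by (intro bij_betwI[where g = "\<lambda>(x, y, z). (x, y)"]) auto
    then show ?thesis by blast
  qed
  then have "CARD('a \<times> 'a) = card ?S" by (metis bij_betw_same_card)
  then show ?thesis by (simp add: power2_eq_square)
qed

section \<open>Counting in \<open>GL(3)\<close>\<close>

text \<open>A normal vector to two rows: the determinant with rows u, v, w is its scalar product
  with w, so singularity becomes a linear equation in w.\<close>

definition cross_product :: "'a::field \<times> 'a \<times> 'a \<Rightarrow> 'a \<times> 'a \<times> 'a \<Rightarrow> 'a \<times> 'a \<times> 'a" where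
  "cross_product = (\<lambda>(a, b, c) (d, e, f). (b * f - c * e, c * d - a * f, a * e - b * d))"

lemma card_cross_product_eq_0:
  fixes u :: "'a::{field,finite} \<times> 'a \<times> 'a"
  assumes "u \<noteq> 0"
  shows "card {v. cross_product u v = 0} = CARD('a)"
proof -
  obtain a b c where u: "u = (a, b, c)" by (cases u)
  have nz: "a \<noteq> 0 \<or> b \<noteq> 0 \<or> c \<noteq> 0" using assms by (auto simp: u zero_prod_def)
  let ?f = "\<lambda>k. (k * a, k * b, k * c)"
  have "{v. cross_product u v = 0} = range ?f"
  proof (intro Set.set_eqI iffI)
    fix v assume "v \<in> {v. cross_product u v = 0}"
    moreover obtain d e f where v: "v = (d, e, f)" by (cases v)
    ultimately have eqs: "b * f = c * e" "c * d = a * f" "a * e = b * d"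
      by (simp_all add: u cross_product_def zero_prod_def)
    from nz consider "a \<noteq> 0" | "b \<noteq> 0" | "c \<noteq> 0" by blast
    then have "\<exists>k. v = ?f k"
    proof cases
      case 1
      then have "v = ?f (d / a)" using eqs by (simp add: v field_simps)
      then show ?thesis by blast
    next
      case 2
      then have "v = ?f (e / b)" using eqs by (simp add: v field_simps)
      then show ?thesis by blast
    next
      case 3
      then have "v = ?f (f / c)" using eqs by (simp add: v field_simps)
      then show ?thesis by blast
    qed
    then show "v \<in> range ?f" by blast
  qed (auto simp: u cross_product_def zero_prod_def algebra_simps)
  moreover have "inj ?f" using nz by (auto simp: inj_on_def)
  ultimately show ?thesis by (simp add: card_image)
qed

text \<open>Rows are chosen in turn: a nonzero u, then v off the line of u, then w off the plane
  normal to their cross product. The last condition is literally det \<noteq> 0, so no theory of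
  spans enters.\<close>

lemma card_GL3:
  "card {A :: 'a::{field,finite} ^ 3 ^ 3. invertible A} =
   (CARD('a) ^ 3 - 1) * (CARD('a) ^ 3 - CARD('a)) * (CARD('a) ^ 3 - CARD('a) ^ 2)"
proof -
  let ?P = "SIGMA u : UNIV - {0 :: 'a \<times> 'a \<times> 'a}. UNIV - {v. cross_product u v = 0}"
  let ?plane = "\<lambda>n. {w. fst n * fst w + fst (snd n) * fst (snd w) + snd (snd n) * snd (snd w) = (0 :: 'a)}"
  let ?Q = "SIGMA p : ?P. UNIV - ?plane (cross_product (fst p) (snd p))"
  let ?row = "\<lambda>u :: 'a \<times> 'a \<times> 'a. [fst u, fst (snd u), snd (snd u)]"
  let ?f = "\<lambda>p. mat3 [?row (fst (fst p)), ?row (snd (fst p)), ?row (snd p)]"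
  have compl: "card (UNIV - S) = CARD('a) ^ 3 - card S" for S :: "('a \<times> 'a \<times> 'a) set"
    by (simp add: card_Diff_subset power3_eq_cube)
  have plane: "card (?plane n) = CARD('a) ^ 2" if "n \<noteq> 0" for n
  proof -
    obtain a b c where n: "n = (a, b, c)" by (cases n)
    have "?plane n = {(x, y, z). a * x + b * y + c * z = 0}" by (auto simp: n)
    then show ?thesis using card_plane[of a b c] that by (simp add: n)
  qed
  let ?GL = "{A :: 'a ^ 3 ^ 3. invertible A}"
  let ?g = "\<lambda>A :: 'a ^ 3 ^ 3. (((A $ 1 $ 1, A $ 1 $ 2, A $ 1 $ 3),
      (A $ 2 $ 1, A $ 2 $ 2, A $ 2 $ 3)), (A $ 3 $ 1, A $ 3 $ 2, A $ 3 $ 3))"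
  have "bij_betw ?f ?Q ?GL"
  proof (rule bij_betwI[where g = ?g])
    show "?f \<in> ?Q \<rightarrow> ?GL"
      by (auto simp: invertible_det_nz det_mat3 cross_product_def algebra_simps)
    show "?g \<in> ?GL \<rightarrow> ?Q"
    proof (rule Pi_I)
      fix A :: "'a ^ 3 ^ 3" assume A: "A \<in> ?GL"
      obtain a b c d e f g h i where Ae: "A = mat3 [[a, b, c], [d, e, f], [g, h, i]]"
        by (rule mat3_cases)
      have det: "(b * f - c * e) * g + (c * d - a * f) * h + (a * e - b * d) * i \<noteq> 0"
        using A by (simp add: invertible_det_nz Ae det_mat3 algebra_simps)
      then have 3: "(g, h, i) \<in> UNIV - ?plane (cross_product (a, b, c) (d, e, f))"
        by (simp add: cross_product_def)
      from det have cross: "cross_product (a, b, c) (d, e, f) \<noteq> 0"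
        by (auto simp: cross_product_def zero_prod_def)
      then have 2: "(d, e, f) \<in> UNIV - {v. cross_product (a, b, c) v = 0}" by blast
      from cross have 1: "(a, b, c) \<in> UNIV - {0}"
        by (auto simp: cross_product_def zero_prod_def)
      show "?g A \<in> ?Q"
        unfolding Ae mat3_nth using 1 2 3 by (intro SigmaI) (simp_all only: fst_conv snd_conv)
    qed
    show "?g (?f p) = p" for p
      by simp
    show "?f (?g A) = A" for A
      by (simp only: fst_conv snd_conv mat3_eta[symmetric])
  qed
  then have "card ?GL = card ?Q"
    by (rule bij_betw_same_card[symmetric])
  also have "\<dots> = (\<Sum>p\<in>?P. card (UNIV - ?plane (cross_product (fst p) (snd p))))"
    by (rule card_SigmaI) auto
  also have "\<dots> = (\<Sum>p\<in>?P. CARD('a) ^ 3 - CARD('a) ^ 2)"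
  proof (intro sum.cong refl)
    fix p assume "p \<in> ?P"
    then have "cross_product (fst p) (snd p) \<noteq> 0" by auto
    from plane[OF this] show "card (UNIV - ?plane (cross_product (fst p) (snd p))) = CARD('a) ^ 3 - CARD('a) ^ 2"
      unfolding compl by (rule arg_cong)
  qed
  also have "\<dots> = card ?P * (CARD('a) ^ 3 - CARD('a) ^ 2)" by (simp only: sum_constant of_nat_id)
  also have "card ?P = (\<Sum>u\<in>UNIV - {0 :: 'a \<times> 'a \<times> 'a}. card (UNIV - {v. cross_product u v = 0}))"
    by (rule card_SigmaI) auto
  also have "\<dots> = (\<Sum>u\<in>UNIV - {0 :: 'a \<times> 'a \<times> 'a}. CARD('a) ^ 3 - CARD('a))"
    unfolding compl by (intro sum.cong refl) (simp add: card_cross_product_eq_0)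
  also have "\<dots> = (CARD('a) ^ 3 - 1) * (CARD('a) ^ 3 - CARD('a))"
    unfolding sum_constant compl by simp
  finally show ?thesis .
qed

section \<open>The center and the elements of ZN and ZN1\<close>

lemma center_GL3: "center (GL :: ('a::field ^ 3 ^ 3) monoid) = {mat a | a. a \<noteq> 0}"
proof (intro Set.set_eqI iffI)
  fix A :: "'a ^ 3 ^ 3" assume "A \<in> center GL"
  then have inv: "det A \<noteq> 0" and comm: "A ** B = B ** A" if "det B \<noteq> 0" for B
    using that by (auto simp: center_def GL_def invertible_det_nz)
  obtain a b c d e f g h i where A: "A = mat3 [[a, b, c], [d, e, f], [g, h, i]]"
    by (rule mat3_cases)
  \<comment> \<open>Three transvections, 1 + E12, 1 + E23 and 1 + E31, already force a matrix
    commuting with them to be scalar.\<close>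
  have "A ** mat3 [[1, 1, 0], [0, 1, 0], [0, 0, 1]] = mat3 [[1, 1, 0], [0, 1, 0], [0, 0, 1]] ** A"
    by (rule comm) (simp add: det_mat3)
  then have 1: "d = 0" "f = 0" "g = 0" "a = e" by (simp_all add: A mat3_mult mat3_eq_iff)
  have "A ** mat3 [[1, 0, 0], [0, 1, 1], [0, 0, 1]] = mat3 [[1, 0, 0], [0, 1, 1], [0, 0, 1]] ** A"
    by (rule comm) (simp add: det_mat3)
  then have 2: "h = 0" "b = 0" "e = i" by (simp_all add: A mat3_mult mat3_eq_iff)
  have "A ** mat3 [[1, 0, 0], [0, 1, 0], [1, 0, 1]] = mat3 [[1, 0, 0], [0, 1, 0], [1, 0, 1]] ** A"
    by (rule comm) (simp add: det_mat3)
  then have 3: "c = 0" by (simp add: A mat3_mult mat3_eq_iff)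
  have "A = mat a" using 1 2 3 by (simp add: A mat_eq_mat3)
  moreover have "a \<noteq> 0" using inv[of "mat 1"] 1 2 3 by (simp add: A det_mat3)
  ultimately show "A \<in> {mat a | a. a \<noteq> 0}" by blast
next
  fix A :: "'a ^ 3 ^ 3" assume "A \<in> {mat a | a. a \<noteq> 0}"
  then obtain a where "A = mat a" "a \<noteq> 0" by blast
  have "det A \<noteq> 0" using \<open>a \<noteq> 0\<close> unfolding \<open>A = mat a\<close> mat_eq_mat3 det_mat3 by simp
  then show "A \<in> center GL"
    by (simp add: center_def GL_def invertible_det_nz \<open>A = mat a\<close> mat_commute)
qed

lemma center_set_mult_GL3:
  "center GL <#>\<^bsub>GL\<^esub> N = {mat a ** u | a u. a \<noteq> 0 \<and> u \<in> N}" for N :: "('a::field ^ 3 ^ 3) set"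
  unfolding set_mult_def center_GL3 by (auto simp: GL_def)

text \<open>The parameters are entries of the product, superdiagonal first and corner last, not
  those of the unipotent factor. Class conditions are then free of a, which reappears as a divisor
  inside \<phi>.\<close>

definition scaled_unipotent :: "'a::field \<Rightarrow> 'a \<Rightarrow> 'a \<Rightarrow> 'a \<Rightarrow> 'a ^ 3 ^ 3" where
  "scaled_unipotent a x y z = mat3 [[a, x, z], [0, a, y], [0, 0, a]]"

lemma scaled_unipotent_eq_iff:
  "scaled_unipotent a x y z = scaled_unipotent a' x' y' z' \<longleftrightarrow> a = a' \<and> x = x' \<and> y = y' \<and> z = z'"
  by (auto simp: scaled_unipotent_def mat3_eq_iff)

lemma mat_mult_unipotent:
  "mat a ** mat3 [[1, x, z], [0, 1, y], [0, 0, 1]] = scaled_unipotent a (a * x) (a * y) (a * z)"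
  by (simp add: mat_eq_mat3 mat3_mult scaled_unipotent_def)

lemma ZN_grp_eq:
  "ZN_grp = (\<lambda>(a, x, y, z). scaled_unipotent a x y z) ` ((UNIV - {0}) \<times> UNIV \<times> UNIV \<times> UNIV)"
proof (intro Set.set_eqI iffI)
  fix M :: "'a ^ 3 ^ 3"
  assume "M \<in> ZN_grp"
  then obtain a x y z where "a \<noteq> 0" "M = scaled_unipotent a (a * x) (a * y) (a * z)"
    by (auto simp: ZN_grp_def N_grp_def center_set_mult_GL3 mat_mult_unipotent)
  then show "M \<in> (\<lambda>(a, x, y, z). scaled_unipotent a x y z) ` ((UNIV - {0}) \<times> UNIV \<times> UNIV \<times> UNIV)"
    by (intro image_eqI[where x = "(a, a * x, a * y, a * z)"]) auto
next
  fix M :: "'a ^ 3 ^ 3"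
  assume "M \<in> (\<lambda>(a, x, y, z). scaled_unipotent a x y z) ` ((UNIV - {0}) \<times> UNIV \<times> UNIV \<times> UNIV)"
  then obtain a x y z where a: "a \<noteq> 0" and M: "M = scaled_unipotent a x y z" by auto
  have *: "M = mat a ** mat3 [[1, x / a, z / a], [0, 1, y / a], [0, 0, 1]]"
    using a by (simp add: M mat_mult_unipotent)
  then show "M \<in> ZN_grp"
    unfolding ZN_grp_def center_set_mult_GL3 N_grp_def using a * by blast
qed

lemma ZN1_grp_eq:
  "ZN1_grp = (\<lambda>(a, y, z). scaled_unipotent a 0 y z) ` ((UNIV - {0}) \<times> UNIV \<times> UNIV)"
proof (intro Set.set_eqI iffI)
  fix M :: "'a ^ 3 ^ 3"
  assume "M \<in> ZN1_grp"
  then obtain a y z where "a \<noteq> 0" "M = scaled_unipotent a 0 (a * y) (a * z)"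
    by (auto simp: ZN1_grp_def N1_grp_def center_set_mult_GL3 mat_mult_unipotent)
  then show "M \<in> (\<lambda>(a, y, z). scaled_unipotent a 0 y z) ` ((UNIV - {0}) \<times> UNIV \<times> UNIV)"
    by (intro image_eqI[where x = "(a, a * y, a * z)"]) auto
next
  fix M :: "'a ^ 3 ^ 3"
  assume "M \<in> (\<lambda>(a, y, z). scaled_unipotent a 0 y z) ` ((UNIV - {0}) \<times> UNIV \<times> UNIV)"
  then obtain a y z where a: "a \<noteq> 0" and M: "M = scaled_unipotent a 0 y z" by auto
  have *: "M = mat a ** mat3 [[1, 0, z / a], [0, 1, y / a], [0, 0, 1]]"
    using a by (simp add: M mat_mult_unipotent)
  then show "M \<in> ZN1_grp"
    unfolding ZN1_grp_def center_set_mult_GL3 N1_grp_def using a * by blast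
qed

lemma card_ZN_grp: "card (ZN_grp :: ('a::{field,finite} ^ 3 ^ 3) set) = (CARD('a) - 1) * CARD('a) ^ 3"
  unfolding ZN_grp_eq
  by (subst card_image)
    (auto simp: inj_on_def scaled_unipotent_eq_iff card_cartesian_product power3_eq_cube)

lemma card_ZN1_grp: "card (ZN1_grp :: ('a::{field,finite} ^ 3 ^ 3) set) = (CARD('a) - 1) * CARD('a) ^ 2"
  unfolding ZN1_grp_eq
  by (subst card_image)
    (auto simp: inj_on_def scaled_unipotent_eq_iff card_cartesian_product power2_eq_square)

section \<open>Conjugacy classes inside ZN\<close>

lemma similar_square_diff_mat_eq_0:
  fixes A B :: "'a::field ^ 'n ^ 'n"
  assumes "similar A B" and "(B - mat c) ** (B - mat c) = 0"
  shows "(A - mat c) ** (A - mat c) = 0"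
proof -
  let ?A = "A - mat c" and ?B = "B - mat c"
  obtain P :: "'a ^ 'n ^ 'n" where P: "invertible P" "?A ** P = P ** ?B"
    using similar_diff_mat[OF assms(1), of c] by (auto simp: similar_def)
  have "?A ** ?A ** P = ?A ** (?A ** P)" by (simp only: matrix_mul_assoc)
  also have "\<dots> = ?A ** (P ** ?B)" unfolding P(2) by (rule refl)
  also have "\<dots> = (?A ** P) ** ?B" by (simp only: matrix_mul_assoc)
  also have "\<dots> = P ** (?B ** ?B)" unfolding P(2) by (simp only: matrix_mul_assoc)
  finally have "?A ** ?A ** P = P ** 0" unfolding assms(2) .
  then have "similar (?A ** ?A) 0" using P(1) by (auto simp: similar_def)
  then show ?thesis by (simp add: similar_0_iff)
qed

lemma similar_mat_iff: "similar A (mat a) \<longleftrightarrow> A = mat a"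
proof
  assume "similar A (mat a)"
  then have "similar (A - mat a) 0" using similar_diff_mat[of A "mat a" a] by simp
  then show "A = mat a" by (simp add: similar_0_iff)
qed (simp add: similar_refl)

lemma similar_scaled_unipotent_diagonal:
  assumes "similar A (scaled_unipotent c x y z)" and "A = scaled_unipotent a x' y' z'"
  shows "c = a"
proof -
  have "det (A - mat c) = det (scaled_unipotent c x y z - mat c)"
    using assms(1) by (rule det_diff_mat_similar)
  then show ?thesis
    by (simp add: assms(2) scaled_unipotent_def mat_eq_mat3 mat3_diff det_mat3)
qed

lemma T_a_eq_mat: "T_a a = mat a"
  by (simp add: T_a_def mat_eq_mat3)

lemma scaled_unipotent_0: "scaled_unipotent a 0 0 0 = mat a"
  by (simp add: scaled_unipotent_def mat_eq_mat3)

lemma similar_T_a_scaled_unipotent_iff: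
  "similar (T_a a) (scaled_unipotent c x y z) \<longleftrightarrow> c = a \<and> x = 0 \<and> y = 0 \<and> z = 0"
  using similar_mat_iff[of "scaled_unipotent c x y z" a] similar_sym
  unfolding T_a_eq_mat scaled_unipotent_0[symmetric] scaled_unipotent_eq_iff by metis

lemma similar_T1_a_scaled_unipotent_iff:
  "similar (T1_a a) (scaled_unipotent c x y z) \<longleftrightarrow>
   c = a \<and> x * y = 0 \<and> \<not> (x = 0 \<and> y = 0 \<and> z = 0)"
proof
  assume sim: "similar (T1_a a) (scaled_unipotent c x y z)"
  have T1: "T1_a a = scaled_unipotent a 1 0 0" by (simp add: T1_a_def scaled_unipotent_def)
  have c: "c = a" using similar_scaled_unipotent_diagonal[OF sim T1] .
  \<comment> \<open>The only entry of the square that can be nonzero is x y, in the corner; its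
    vanishing transfers from \<open>T1_a a\<close> by similarity.\<close>
  have "(scaled_unipotent c x y z - mat a) ** (scaled_unipotent c x y z - mat a) = 0"
    by (rule similar_square_diff_mat_eq_0[OF similar_sym[OF sim]])
      (simp add: T1_a_def mat_eq_mat3 mat3_diff mat3_mult zero_eq_mat3)
  then have "x * y = 0"
    by (simp add: c scaled_unipotent_def mat_eq_mat3 mat3_diff mat3_mult zero_eq_mat3 mat3_eq_iff)
  moreover have "\<not> (x = 0 \<and> y = 0 \<and> z = 0)"
  proof
    assume "x = 0 \<and> y = 0 \<and> z = 0"
    then have "T1_a a = mat a" using sim by (simp add: c scaled_unipotent_0 similar_mat_iff)
    then show False by (simp add: T1 scaled_unipotent_eq_iff flip: scaled_unipotent_0)
  qed
  ultimately show "c = a \<and> x * y = 0 \<and> \<not> (x = 0 \<and> y = 0 \<and> z = 0)" using c by blast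
next
  assume "c = a \<and> x * y = 0 \<and> \<not> (x = 0 \<and> y = 0 \<and> z = 0)"
  then show "similar (T1_a a) (scaled_unipotent c x y z)"
    unfolding scaled_unipotent_def using similar_sym[OF similar_T1_a] by blast
qed

lemma similar_T11_a_scaled_unipotent_iff:
  "similar (T11_a a) (scaled_unipotent c x y z) \<longleftrightarrow> c = a \<and> x * y \<noteq> 0"
proof
  assume sim: "similar (T11_a a) (scaled_unipotent c x y z)"
  have T11: "T11_a a = scaled_unipotent a 1 1 0" by (simp add: T11_a_def scaled_unipotent_def)
  have c: "c = a" using similar_scaled_unipotent_diagonal[OF sim T11] .
  have "x * y \<noteq> 0"
  proof
    assume "x * y = 0"
    then have "(T11_a a - mat a) ** (T11_a a - mat a) = 0"
      by (intro similar_square_diff_mat_eq_0[OF sim])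
        (auto simp: c scaled_unipotent_def mat_eq_mat3 mat3_diff mat3_mult zero_eq_mat3)
    then show False
      by (simp add: T11_a_def mat_eq_mat3 mat3_diff mat3_mult zero_eq_mat3 mat3_eq_iff)
  qed
  with c show "c = a \<and> x * y \<noteq> 0" by blast
next
  assume "c = a \<and> x * y \<noteq> 0"
  then show "similar (T11_a a) (scaled_unipotent c x y z)"
    unfolding scaled_unipotent_def using similar_sym[OF similar_T11_a] by blast
qed

section \<open>Values of the induced characters\<close>

lemma add_character_simps:
  assumes "add_character \<phi>"
  shows "\<phi> (x + y) = \<phi> x * \<phi> y" "\<phi> 0 = 1"
proof -
  have hom: "\<phi> x \<noteq> 0" "\<phi> (x + y) = \<phi> x * \<phi> y" for x y
    using assms by (auto simp: add_character_def hom_def additive_group_def units_group_def)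
  show "\<phi> (x + y) = \<phi> x * \<phi> y" by (rule hom(2))
  show "\<phi> 0 = 1" using hom(1)[of 0] hom(2)[of 0 0] by simp
qed

text \<open>Translation by t multiplies the full sum by \<phi> t \<noteq> 1, so that sum is 0; the
  term at 0 equals 1. Dividing by a merely permutes the field.\<close>

lemma sum_nonzero_add_character:
  fixes \<phi> :: "'a::{field,finite} \<Rightarrow> complex"
  assumes \<phi>: "add_character \<phi>" and nontrivial: "\<exists>x. \<phi> x \<noteq> 1" and a: "a \<noteq> 0"
  shows "(\<Sum>x\<in>UNIV - {0}. \<phi> (x / a)) = - 1"
proof -
  obtain t where t: "\<phi> t \<noteq> 1" using nontrivial by blast
  have "(\<Sum>x\<in>UNIV. \<phi> x) = (\<Sum>x\<in>UNIV. \<phi> (t + x))"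
    by (rule sum.reindex_bij_witness[of _ "\<lambda>x. t + x" "\<lambda>x. x - t"]) auto
  also have "\<dots> = \<phi> t * (\<Sum>x\<in>UNIV. \<phi> x)"
    by (simp add: add_character_simps[OF \<phi>] sum_distrib_left)
  finally have "(\<Sum>x\<in>UNIV. \<phi> x) = 0" using t by auto
  moreover have "(\<Sum>x\<in>UNIV. \<phi> x) = (\<Sum>x\<in>UNIV. \<phi> (x / a))"
    by (rule sum.reindex_bij_witness[of _ "\<lambda>x. x / a" "\<lambda>x. x * a"]) (use a in auto)
  moreover have "\<dots> = \<phi> (0 / a) + (\<Sum>x\<in>UNIV - {0}. \<phi> (x / a))"
    by (rule sum.remove) auto
  ultimately show ?thesis by (simp add: add_character_simps[OF \<phi>] add_eq_0_iff)
qed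

lemma central_unipotent_character_scaled_unipotent:
  "central_unipotent_character \<omega> \<phi> (scaled_unipotent a x y z) = \<omega> a * \<phi> ((x + y) / a)"
  by (simp add: central_unipotent_character_def scaled_unipotent_def)

lemma ZN_grpE:
  assumes "M \<in> ZN_grp"
  obtains a x y z where "a \<noteq> 0" "M = scaled_unipotent a x y z"
  using assms by (auto simp: ZN_grp_eq)

lemma ZN1_grpE:
  assumes "M \<in> ZN1_grp"
  obtains a y z where "a \<noteq> 0" "M = scaled_unipotent a 0 y z"
  using assms by (auto simp: ZN1_grp_eq)

lemma scaled_unipotent_in_ZN_grp_iff: "scaled_unipotent a x y z \<in> ZN_grp \<longleftrightarrow> a \<noteq> 0"
proof
  assume "a \<noteq> 0"
  then show "scaled_unipotent a x y z \<in> ZN_grp"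
    unfolding ZN_grp_eq by (intro image_eqI[where x = "(a, x, y, z)"]) auto
qed (auto elim!: ZN_grpE simp: scaled_unipotent_eq_iff)

lemma scaled_unipotent_in_ZN1_grp_iff: "scaled_unipotent a x y z \<in> ZN1_grp \<longleftrightarrow> a \<noteq> 0 \<and> x = 0"
proof
  assume "a \<noteq> 0 \<and> x = 0"
  then show "scaled_unipotent a x y z \<in> ZN1_grp"
    unfolding ZN1_grp_eq by (intro image_eqI[where x = "(a, y, z)"]) auto
qed (auto elim!: ZN1_grpE simp: scaled_unipotent_eq_iff)

text \<open>The second factor is the free corner entry, on which the character does not depend; it
  contributes its size.\<close>

lemma sum_fst_times_UNIV:
  fixes f :: "'a::finite \<Rightarrow> complex"
  shows "(\<Sum>s\<in>A \<times> (UNIV :: 'b::finite set). f (fst s)) = of_nat CARD('b) * (\<Sum>x\<in>A. f x)"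
proof -
  have "(\<Sum>s\<in>A \<times> (UNIV :: 'b set). f (fst s)) = (\<Sum>x\<in>A. \<Sum>y\<in>(UNIV :: 'b set). f x)"
    by (simp only: sum.cartesian_product split_def)
  then show ?thesis by (simp add: sum_distrib_left)
qed

lemma of_nat_card_GL3:
  fixes Q :: complex
  defines "Q \<equiv> of_nat CARD('a::{field,finite})"
  shows "of_nat (card {A :: 'a ^ 3 ^ 3. invertible A}) = (Q ^ 3 - 1) * (Q ^ 3 - Q) * (Q ^ 3 - Q ^ 2)"
    "of_nat (CARD('a) - 1) = Q - 1" "Q \<noteq> 0" "Q \<noteq> 1"
proof -
  have q: "CARD('a) \<ge> 2" by (rule CARD_field_ge_2)
  \<comment> \<open>Subtraction of naturals truncates; these bounds are what lets
    \<open>of_nat\<close> commute with each difference.\<close>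
  then have "CARD('a) \<le> CARD('a) ^ 3" "CARD('a) ^ 2 \<le> CARD('a) ^ 3" "1 \<le> CARD('a) ^ 3"
    by (auto intro: power_increasing self_le_power)
  then show "of_nat (card {A :: 'a ^ 3 ^ 3. invertible A}) = (Q ^ 3 - 1) * (Q ^ 3 - Q) * (Q ^ 3 - Q ^ 2)"
    by (simp add: card_GL3 Q_def of_nat_diff)
  show "of_nat (CARD('a) - 1) = Q - 1" using q by (simp add: Q_def of_nat_diff)
  show "Q \<noteq> 0" "Q \<noteq> 1" using q by (auto simp: Q_def)
qed

context
  fixes \<phi> :: "'a::{field,finite} \<Rightarrow> complex" and \<omega> :: "'a \<Rightarrow> complex" and a :: 'a
  assumes \<phi>: "add_character \<phi>" and nontrivial: "\<exists>x. \<phi> x \<noteq> 1" and a: "a \<noteq> 0"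
begin

private lemma sum_central_unipotent_character_image:
  assumes "inj_on f S" and "\<And>s. s \<in> S \<Longrightarrow> f s = scaled_unipotent a (x s) (y s) (z s)"
  shows "(\<Sum>M\<in>f ` S. central_unipotent_character \<omega> \<phi> M) = \<omega> a * (\<Sum>s\<in>S. \<phi> (x s / a) * \<phi> (y s / a))"
  unfolding sum.reindex[OF assms(1)] sum_distrib_left
  by (rule sum.cong) (simp_all add: assms(2) central_unipotent_character_scaled_unipotent
      add_divide_distrib add_character_simps[OF \<phi>])

private lemma sum_T_a:
  "(\<Sum>M\<in>{M\<in>ZN_grp. similar (T_a a) M}. central_unipotent_character \<omega> \<phi> M) = \<omega> a"
  "(\<Sum>M\<in>{M\<in>ZN1_grp. similar (T_a a) M}. central_unipotent_character \<omega> \<phi> M) = \<omega> a"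
proof -
  have "{M\<in>ZN_grp. similar (T_a a) M} = {scaled_unipotent a 0 0 0}"
    using a by (auto elim!: ZN_grpE simp: scaled_unipotent_in_ZN_grp_iff similar_T_a_scaled_unipotent_iff)
  moreover have "{M\<in>ZN1_grp. similar (T_a a) M} = {scaled_unipotent a 0 0 0}"
    using a by (auto elim!: ZN1_grpE simp: scaled_unipotent_in_ZN1_grp_iff similar_T_a_scaled_unipotent_iff)
  ultimately show "(\<Sum>M\<in>{M\<in>ZN_grp. similar (T_a a) M}. central_unipotent_character \<omega> \<phi> M) = \<omega> a"
    "(\<Sum>M\<in>{M\<in>ZN1_grp. similar (T_a a) M}. central_unipotent_character \<omega> \<phi> M) = \<omega> a"
    by (simp_all add: central_unipotent_character_scaled_unipotent add_character_simps[OF \<phi>])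
qed

text \<open>The condition x y = 0 with a nonzero entry gives three disjoint pieces: only x nonzero
  with z free, only y nonzero with z free, and x = y = 0 with z nonzero. They contribute -q, -q and
  q - 1; the first is absent in ZN1.\<close>

private lemma sum_T1_a:
  "(\<Sum>M\<in>{M\<in>ZN1_grp. similar (T1_a a) M}. central_unipotent_character \<omega> \<phi> M) = - \<omega> a" (is ?ZN1)
  "(\<Sum>M\<in>{M\<in>ZN_grp. similar (T1_a a) M}. central_unipotent_character \<omega> \<phi> M) = - (of_nat CARD('a) + 1) * \<omega> a" (is ?ZN)
proof -
  let ?X = "(\<lambda>(x, z). scaled_unipotent a x 0 z) ` ((UNIV - {0}) \<times> UNIV)"
  let ?Y = "(\<lambda>(y, z). scaled_unipotent a 0 y z) ` ((UNIV - {0}) \<times> UNIV)"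
  let ?Z = "(\<lambda>z. scaled_unipotent a 0 0 z) ` (UNIV - {0})"
  note sum = sum_nonzero_add_character[OF \<phi> nontrivial a]
  have X: "(\<Sum>M\<in>?X. central_unipotent_character \<omega> \<phi> M) = - of_nat CARD('a) * \<omega> a"
    by (subst sum_central_unipotent_character_image[where x = fst and y = "\<lambda>_. 0" and z = snd])
      (auto simp: inj_on_def scaled_unipotent_eq_iff add_character_simps[OF \<phi>]
        sum_fst_times_UNIV[of "\<lambda>x. \<phi> (x / a)"] sum)
  have Y: "(\<Sum>M\<in>?Y. central_unipotent_character \<omega> \<phi> M) = - of_nat CARD('a) * \<omega> a"
    by (subst sum_central_unipotent_character_image[where x = "\<lambda>_. 0" and y = fst and z = snd])
      (auto simp: inj_on_def scaled_unipotent_eq_iff add_character_simps[OF \<phi>]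
        sum_fst_times_UNIV[of "\<lambda>x. \<phi> (x / a)"] sum)
  have Z: "(\<Sum>M\<in>?Z. central_unipotent_character \<omega> \<phi> M) = (of_nat CARD('a) - 1) * \<omega> a"
    by (subst sum_central_unipotent_character_image[where x = "\<lambda>_. 0" and y = "\<lambda>_. 0" and z = "\<lambda>z. z"])
      (auto simp: inj_on_def scaled_unipotent_eq_iff add_character_simps[OF \<phi>] of_nat_diff)
  have ZN1: "{M\<in>ZN1_grp. similar (T1_a a) M} = ?Y \<union> ?Z"
    using a by (auto elim!: ZN1_grpE simp: scaled_unipotent_in_ZN1_grp_iff similar_T1_a_scaled_unipotent_iff
        image_iff Bex_def scaled_unipotent_eq_iff)
  have ZN: "{M\<in>ZN_grp. similar (T1_a a) M} = ?X \<union> (?Y \<union> ?Z)"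
    using a by (auto elim!: ZN_grpE simp: scaled_unipotent_in_ZN_grp_iff similar_T1_a_scaled_unipotent_iff
        image_iff Bex_def scaled_unipotent_eq_iff)
  have disj: "?Y \<inter> ?Z = {}" "?X \<inter> (?Y \<union> ?Z) = {}"
    by (auto simp: scaled_unipotent_eq_iff)
  show ?ZN1 unfolding ZN1
    by (subst sum.union_disjoint) (simp_all add: disj Y Z algebra_simps)
  then have YZ: "(\<Sum>M\<in>?Y \<union> ?Z. central_unipotent_character \<omega> \<phi> M) = - \<omega> a" unfolding ZN1 .
  show ?ZN unfolding ZN
    by (subst sum.union_disjoint) (simp_all only: finite disj X YZ, simp add: algebra_simps)
qed

text \<open>In ZN the entries x and y are independent and nonzero, giving (-1)(-1), and z is free,
  giving q. In ZN1 the entry x is 0, so the class is not met.\<close>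

private lemma sum_T11_a:
  "(\<Sum>M\<in>{M\<in>ZN1_grp. similar (T11_a a) M}. central_unipotent_character \<omega> \<phi> M) = 0"
  "(\<Sum>M\<in>{M\<in>ZN_grp. similar (T11_a a) M}. central_unipotent_character \<omega> \<phi> M) = of_nat CARD('a) * \<omega> a"
proof -
  have "{M\<in>ZN1_grp. similar (T11_a a) M} = {}"
    by (auto elim!: ZN1_grpE simp: scaled_unipotent_in_ZN1_grp_iff similar_T11_a_scaled_unipotent_iff)
  then show "(\<Sum>M\<in>{M\<in>ZN1_grp. similar (T11_a a) M}. central_unipotent_character \<omega> \<phi> M) = 0" by (simp only: sum.empty)
  let ?S = "(UNIV - {0 :: 'a}) \<times> (UNIV - {0 :: 'a}) \<times> (UNIV :: 'a set)"
  note sum = sum_nonzero_add_character[OF \<phi> nontrivial a]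
  have "{M\<in>ZN_grp. similar (T11_a a) M} = (\<lambda>(x, y, z). scaled_unipotent a x y z) ` ?S"
    using a by (auto elim!: ZN_grpE simp: scaled_unipotent_in_ZN_grp_iff similar_T11_a_scaled_unipotent_iff
        image_iff Bex_def scaled_unipotent_eq_iff)
  also have "(\<Sum>M\<in>\<dots>. central_unipotent_character \<omega> \<phi> M) = \<omega> a * (\<Sum>s\<in>?S. \<phi> (fst s / a) * \<phi> (fst (snd s) / a))"
    by (rule sum_central_unipotent_character_image[where z = "\<lambda>s. snd (snd s)"])
      (auto simp: inj_on_def scaled_unipotent_eq_iff)
  also have "(\<Sum>s\<in>?S. \<phi> (fst s / a) * \<phi> (fst (snd s) / a)) = of_nat CARD('a)"
  proof -
    have inner: "(\<Sum>p\<in>(UNIV - {0}) \<times> (UNIV :: 'a set). \<phi> (x / a) * \<phi> (fst p / a)) =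
        - of_nat CARD('a) * \<phi> (x / a)" for x
      using sum_fst_times_UNIV[where 'b = 'a, of "\<lambda>y. \<phi> (x / a) * \<phi> (y / a)" "UNIV - {0}"]
      by (simp add: sum_distrib_left[symmetric] sum)
    have "(\<Sum>s\<in>?S. \<phi> (fst s / a) * \<phi> (fst (snd s) / a)) =
        (\<Sum>x\<in>UNIV - {0}. \<Sum>p\<in>(UNIV - {0}) \<times> (UNIV :: 'a set). \<phi> (x / a) * \<phi> (fst p / a))"
      by (simp only: sum.cartesian_product split_def)
    also have "\<dots> = - of_nat CARD('a) * (\<Sum>x\<in>UNIV - {0}. \<phi> (x / a))"
      unfolding inner by (rule sum_distrib_left[symmetric])
    finally show ?thesis unfolding sum by simp
  qed
  finally show "(\<Sum>M\<in>{M\<in>ZN_grp. similar (T11_a a) M}. central_unipotent_character \<omega> \<phi> M) = of_nat CARD('a) * \<omega> a"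
    by (simp add: mult.commute)
qed

text \<open>On scalars an induced character is the index times \<omega>: the indices are (q^3 -
  1)(q^2 - 1) for ZN and q times that for ZN1.\<close>

lemma induced_character_T_a:
  fixes Q :: complex
  defines "Q \<equiv> of_nat CARD('a)"
  assumes "similar g (T_a a)"
  shows "induced_character GL ZN_grp (central_unipotent_character \<omega> \<phi>) g +
      induced_character GL ZN1_grp (central_unipotent_character \<omega> \<phi>) g =
    (Q ^ 3 - 1) * (Q\<^sup>2 - 1) * (Q + 1) * \<omega> a"
proof -
  note Q = of_nat_card_GL3[where 'a = 'a, folded Q_def]
  have "centralizer_GL (T_a a) = {A. invertible A}"
    by (simp add: T_a_eq_mat centralizer_GL_scalar)
  then show ?thesis
    unfolding induced_character_GL_eq[OF assms(2)] sum_T_a card_ZN_grp card_ZN1_grp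
      of_nat_mult of_nat_power Q Q_def[symmetric]
    using Q(3,4) by (simp add: divide_simps) (simp add: Q algebra_simps eval_nat_numeral)
qed

text \<open>The centralizer has order (q - 1)^2 q^3, so ZN contributes -(q - 1)(q + 1) and ZN1
  contributes -(q - 1) q.\<close>

lemma induced_character_T1_a:
  fixes Q :: complex
  defines "Q \<equiv> of_nat CARD('a)"
  assumes "similar g (T1_a a)"
  shows "induced_character GL ZN_grp (central_unipotent_character \<omega> \<phi>) g +
      induced_character GL ZN1_grp (central_unipotent_character \<omega> \<phi>) g =
    - (Q - 1) * (2 * Q + 1) * \<omega> a"
proof -
  note Q = of_nat_card_GL3[where 'a = 'a, folded Q_def]
  show ?thesis
    unfolding induced_character_GL_eq[OF assms(2)] sum_T1_a card_ZN_grp card_ZN1_grp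
      card_centralizer_T1_a of_nat_mult of_nat_power Q Q_def[symmetric]
    using Q(3,4) by (simp add: divide_simps) (simp add: algebra_simps eval_nat_numeral)
qed

lemma induced_character_T11_a:
  assumes "similar g (T11_a a)"
  shows "induced_character GL ZN_grp (central_unipotent_character \<omega> \<phi>) g +
      induced_character GL ZN1_grp (central_unipotent_character \<omega> \<phi>) g = \<omega> a"
proof -
  define Q :: complex where "Q = of_nat CARD('a)"
  note Q = of_nat_card_GL3[where 'a = 'a, folded Q_def]
  show ?thesis
    unfolding induced_character_GL_eq[OF assms] sum_T11_a card_ZN_grp card_ZN1_grp
      card_centralizer_T11_a of_nat_mult of_nat_power Q Q_def[symmetric]
    using Q(3,4) by (simp add: divide_simps) (simp add: algebra_simps eval_nat_numeral)
qed

end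

section \<open>Comparison of the two sides on each class\<close>

lemma scaled_unipotent_cases:
  obtains "similar (scaled_unipotent a x y z) (T_a a)"
  | "similar (scaled_unipotent a x y z) (T1_a a)"
  | "similar (scaled_unipotent a x y z) (T11_a a)"
  using similar_sym similar_T_a_scaled_unipotent_iff similar_T1_a_scaled_unipotent_iff
    similar_T11_a_scaled_unipotent_iff by metis

lemma induced_character_not_unipotent:
  fixes g :: "'a::{field,finite} ^ 3 ^ 3"
  assumes "\<And>c. \<not> unipotent_up_to_scalar g c" and "H = ZN_grp \<or> H = ZN1_grp"
  shows "induced_character GL H \<theta> g = 0"
proof -
  have "\<not> similar g (scaled_unipotent c x y z)" for c x y z
  proof
    assume sim: "similar g (scaled_unipotent c x y z)"
    have "unipotent_up_to_scalar (scaled_unipotent c x y z) c"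
      unfolding unipotent_up_to_scalar_def scaled_unipotent_def
      by (rule cube_upper_triangular_diff_mat)
    then show False using assms(1) similar_unipotent_up_to_scalar[OF sim] by blast
  qed
  then have "{y\<in>H. similar g y} = {}"
    using assms(2) by (auto elim!: ZN_grpE ZN1_grpE)
  then show ?thesis unfolding induced_character_GL_eq[OF similar_refl]
    by (simp only: sum.empty mult_zero_right div_0)
qed

theorem proposition1:
  fixes q :: nat
    and \<iota>\<^sub>2 :: "'k::{field,finite} \<Rightarrow> 'e::{field,finite}" and \<tau> :: 'e
    and \<iota>\<^sub>3 :: "'k \<Rightarrow> 'l::{field,finite}" and \<sigma> :: 'l
    and \<psi> :: "'l \<Rightarrow> complex" and \<beta> \<gamma> \<delta> \<phi> :: "'k \<Rightarrow> complex"
    and D :: "'k ^ 3 ^ 3 \<Rightarrow> complex ^ 'm ^ 'm"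
    and P :: "'k ^ 3 ^ 3 \<Rightarrow> complex ^ 'n ^ 'n"
  assumes "CARD('k) = q" and "CARD('e) = q\<^sup>2" and "CARD('l) = q ^ 3"
    and "field_embedding \<iota>\<^sub>2" and "generator_over \<iota>\<^sub>2 \<tau>"
    and "field_embedding \<iota>\<^sub>3" and "generator_over \<iota>\<^sub>3 \<sigma>"
    and "mult_character \<psi>" and "\<exists>x. x \<noteq> 0 \<and> \<psi> x \<noteq> \<psi> (x ^ q)"
    and "mult_character \<beta>" and "mult_character \<gamma>" and "mult_character \<delta>"
    and "\<exists>x. x \<noteq> 0 \<and> \<beta> x \<noteq> \<gamma> x" and "\<exists>x. x \<noteq> 0 \<and> \<beta> x \<noteq> \<delta> x"
    and "\<exists>x. x \<noteq> 0 \<and> \<gamma> x \<noteq> \<delta> x"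
    and "add_character \<phi>" and "\<exists>x. \<phi> x \<noteq> 1"
    and "irreducible_representation GL D"
    and "discrete_series_values \<iota>\<^sub>2 \<tau> \<iota>\<^sub>3 \<sigma> \<psi> (character D)"
    and "irreducible_representation GL P"
    and "principal_series_values \<iota>\<^sub>2 \<tau> \<iota>\<^sub>3 \<sigma> \<beta> \<gamma> \<delta> (character P)"
  shows "\<forall>g\<in>carrier GL. character D g * character P g =
    induced_character GL ZN_grp
      (central_unipotent_character (\<lambda>a. \<psi> (\<iota>\<^sub>3 a) * \<beta> a * \<gamma> a * \<delta> a) \<phi>) g +
    induced_character GL ZN1_grp
      (central_unipotent_character (\<lambda>a. \<psi> (\<iota>\<^sub>3 a) * \<beta> a * \<gamma> a * \<delta> a) \<phi>) g"
proof
  fix g :: "'k ^ 3 ^ 3" assume "g \<in> carrier GL"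
  then have g: "invertible g" "det g \<noteq> 0" by (simp_all add: GL_def invertible_det_nz)
  let ?\<omega> = "\<lambda>a. \<psi> (\<iota>\<^sub>3 a) * \<beta> a * \<gamma> a * \<delta> a"
  let ?R = "induced_character GL ZN_grp (central_unipotent_character ?\<omega> \<phi>) g +
    induced_character GL ZN1_grp (central_unipotent_character ?\<omega> \<phi>) g"
  define Q :: complex where "Q = of_nat CARD('k)"
  note D = assms(19)[unfolded discrete_series_values_def Let_def, folded Q_def]
  note P = assms(21)[unfolded principal_series_values_def Let_def, folded Q_def]
  have char: "character D g = character D t" "character P g = character P t" if "similar g t" for t
  proof -
    have "invertible t" using g det_similar[OF that] by (simp add: invertible_det_nz)
    then show "character D g = character D t" "character P g = character P t"
      using character_similar[OF _ g(1) _ that] assms(18,20) by blast+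
  qed
  \<comment> \<open>Only the product is asked to vanish, since which factor is zero depends on the
    class.\<close>
  have nonunipotent: "character D g * character P g = ?R"
    if "similar g t" "character D t * character P t = 0" "\<And>c. \<not> unipotent_up_to_scalar g c" for t
    using that by (simp add: char[OF that(1)] induced_character_not_unipotent)
  have K: "CARD('e) = CARD('k) ^ 2" "CARD('l) = CARD('k) ^ 3" using assms(1-3) by simp_all
  show "character D g * character P g = ?R"
    using K assms(4,6,5,7) g(2)
  proof (cases rule: GL3_classification)
    case (unipotent a x y z)
    note ind = induced_character_T_a induced_character_T1_a induced_character_T11_a
    note ind = ind[OF assms(16,17) unipotent(1), where \<omega> = ?\<omega>, folded Q_def]
    have sim: "similar g (scaled_unipotent a x y z)"
      using unipotent(2) by (simp add: scaled_unipotent_def)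
    show ?thesis
    proof (cases rule: scaled_unipotent_cases[of a x y z])
      case 1
      then have t: "similar g (T_a a)" by (rule similar_trans[OF sim])
      have vals: "character D (T_a a) = (Q - 1) * (Q\<^sup>2 - 1) * \<psi> (\<iota>\<^sub>3 a)"
        "character P (T_a a) = (Q + 1) * (Q\<^sup>2 + Q + 1) * (\<beta> a * \<gamma> a * \<delta> a)"
        using D[THEN conjunct1, rule_format, OF unipotent(1)] P[THEN conjunct1, rule_format, OF unipotent(1)] by simp_all
      \<comment> \<open>The two degrees match through (Q - 1)(Q^2 + Q + 1) = Q^3 - 1.\<close>
      show ?thesis unfolding char[OF t] ind(1)[OF t] vals
        by (simp add: algebra_simps power2_eq_square power3_eq_cube)
    next
      case 2
      then have t: "similar g (T1_a a)" by (rule similar_trans[OF sim])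
      have vals: "character D (T1_a a) = - (Q - 1) * \<psi> (\<iota>\<^sub>3 a)"
        "character P (T1_a a) = (2 * Q + 1) * (\<beta> a * \<gamma> a * \<delta> a)"
        using D[THEN conjunct2, THEN conjunct1, rule_format, OF unipotent(1)]
          P[THEN conjunct2, THEN conjunct1, rule_format, OF unipotent(1)] by simp_all
      show ?thesis unfolding char[OF t] ind(2)[OF t] vals by (simp add: algebra_simps)
    next
      case 3
      then have t: "similar g (T11_a a)" by (rule similar_trans[OF sim])
      have vals: "character D (T11_a a) = \<psi> (\<iota>\<^sub>3 a)" "character P (T11_a a) = \<beta> a * \<gamma> a * \<delta> a"
        using D[THEN conjunct2, THEN conjunct2, THEN conjunct1, rule_format, OF unipotent(1)]
          P[THEN conjunct2, THEN conjunct2, THEN conjunct1, rule_format, OF unipotent(1)] by simp_all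
      show ?thesis unfolding char[OF t] ind(3)[OF t] vals by simp
    qed
  next
    case (T_ab a b)
    have "character D (T_ab a b) = 0"
      using D[THEN conjunct2, THEN conjunct2, THEN conjunct2, THEN conjunct1, rule_format] T_ab(1-3) by simp
    then show ?thesis by (intro nonunipotent[OF T_ab(4) _ T_ab(5)]) simp
  next
    case (T1_ab a b)
    have "character D (T1_ab a b) = 0"
      using D[THEN conjunct2, THEN conjunct2, THEN conjunct2, THEN conjunct2, THEN conjunct1, rule_format] T1_ab(1-3) by simp
    then show ?thesis by (intro nonunipotent[OF T1_ab(4) _ T1_ab(5)]) simp
  next
    case (T_abc a b c)
    have "character D (T_abc a b c) = 0"
      using D[THEN conjunct2, THEN conjunct2, THEN conjunct2, THEN conjunct2, THEN conjunct2, THEN conjunct1, rule_format] T_abc(1-4) by simp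
    then show ?thesis by (intro nonunipotent[OF T_abc(5) _ T_abc(6)]) simp
  next
    case (T_ka \<kappa> a)
    have "character D (T_ka \<iota>\<^sub>2 \<tau> \<kappa> a) = 0"
      using D[THEN conjunct2, THEN conjunct2, THEN conjunct2, THEN conjunct2, THEN conjunct2, THEN conjunct2, THEN conjunct1, rule_format] T_ka(1,2) by simp
    then show ?thesis by (intro nonunipotent[OF T_ka(3) _ T_ka(4)]) simp
  next
    case (T_z z)
    \<comment> \<open>The one nonunipotent type where the vanishing is taken from the principal
      series: here the discrete series has value \<psi>(z) + \<psi>(z^q) + \<psi>(z^(q^2)).\<close>
    have "character P (T_z \<iota>\<^sub>3 \<sigma> z) = 0"
      using P[THEN conjunct2, THEN conjunct2, THEN conjunct2, THEN conjunct2, THEN conjunct2, THEN conjunct2, THEN conjunct2, rule_format] T_z(1) by simp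
    then show ?thesis by (intro nonunipotent[OF T_z(2) _ T_z(3)]) simp
  qed
qed

end
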